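(* Let $\Phi_2(z)=\sum_{n\ge0}z^{4^n/3}$. Then, for the generating function $S_{\mathfrak H(5)}(z)=\sum_{n=0}^\infty s_{n+1}(\mathfrak H(5))z^n$ of the subgroup numbers of $\mathfrak H(5)$, we have, modulo $16$, \begin{align*} S_{\mathfrak H(5)}(z)={}&8z^{12}+4z^9+8z^7+8z^5+2z^4+8z^2+4z+14+\tfrac{7}{z^3}\\ &+\Big(8z^{20/3}+8z^{5/3}+\tfrac{8}{z^{1/3}}+\tfrac{8}{z^{4/3}}+\tfrac{12}{z^{10/3}}\Big)\Phi_2(z)\\ &+\Big(8z^{19/3}+8z^{4/3}+\tfrac{12}{z^{2/3}}+\tfrac{8}{z^{5/3}}+\tfrac{10}{z^{11/3}}\Big)\Phi_2^2(z) +\Big(8z^6+8z+\tfrac{8}{z}+\tfrac{12}{z^4}\Big)\Phi_2^3(z)\\ &+\Big(8z^{32/3}+8z^{20/3}+8z^{11/3}+8z^{8/3}+8z^{5/3}+\tfrac{6}{z^{4/3}}+\tfrac{8}{z^{7/3}}+\tfrac{12}{z^{10/3}}+\tfrac{7}{z^{13/3}}\Big)\Phi_2^4(z)\\ &+\Big(\tfrac{8}{z^{2/3}}+\tfrac{8}{z^{5/3}}+\tfrac{8}{z^{8/3}}+\tfrac{4}{z^{11/3}}\Big)\Phi_2^5(z) +\Big(8z^6+8z+\tfrac{8}{z}+\tfrac{12}{z^2}+\tfrac{4}{z^4}\Big)\Phi_2^6(z)\\ &+\Big(\tfrac{8}{z^{4/3}}+\tfrac{8}{z^{7/3}}+\tfrac{12}{z^{13/3}}\Big)\Phi_2^7(z)\\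 &+\Big(8z^{22/3}+8z^{19/3}+8z^{16/3}+8z^{10/3}+12z^{7/3}+8z^{4/3}+\tfrac{4}{z^{2/3}}+\tfrac{8}{z^{5/3}}+\tfrac{5}{z^{8/3}}+\tfrac{2}{z^{11/3}}\Big)\Phi_2^8(z)\\ &+\Big(8z^6+8z+\tfrac{8}{z}+\tfrac{4}{z^4}+\tfrac{8}{z^2}\Big)\Phi_2^9(z) +\Big(\tfrac{12}{z^{4/3}}+\tfrac{2}{z^{13/3}}\Big)\Phi_2^{10}(z)+\tfrac{8}{z^{8/3}}\Phi_2^{11}(z)\\ &+\Big(8z^6+8z^4+8z+8+\tfrac{8}{z}+\tfrac{12}{z^2}+\tfrac{12}{z^3}+\tfrac{12}{z^4}\Big)\Phi_2^{12}(z)\\ &+\Big(\tfrac{8}{z^{4/3}}+\tfrac{8}{z^{7/3}}+\tfrac{12}{z^{13/3}}\Big)\Phi_2^{13}(z) +\Big(\tfrac{4}{z^{8/3}}+\tfrac{8}{z^{11/3}}\Big)\Phi_2^{14}(z). \end{align*}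
   Context: $\mathfrak H(5)=C_2*C_5$ is the Hecke group (free product of cyclic groups of orders $2$ and $5$). $s_n(\Gamma)$ denotes the number of subgroups of index $n$ in the finitely generated group $\Gamma$. Series are regarded as formal Laurent series in $z^{1/3}$ with integer coefficients; an equality "modulo $M$" means that coefficients of equal powers agree modulo $M$. $\Phi_2^i(z)$ denotes $(\Phi_2(z))^i$. *)

theory Defs
  imports
    "HOL-Algebra.Algebra"
    "HOL-Computational_Algebra.Formal_Laurent_Series"
    "HOL-Number_Theory.Cong"
begin

text \<open>
  The free product of \<open>G\<close> and \<open>H\<close> consists of the words over the disjoint union of the two
  carriers, modulo the congruence (with respect to concatenation) that deletes identity letters
  and multiplies adjacent letters coming from the same factor.
\<close>

abbreviation free_product_words ::
    "('a, 'c) monoid_scheme \<Rightarrow> ('b, 'd) monoid_scheme \<Rightarrow> ('a + 'b) list set" where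
  "free_product_words G H \<equiv> lists (Sum_Type.Plus (carrier G) (carrier H))"

inductive_set free_product_rel ::
    "('a, 'c) monoid_scheme \<Rightarrow> ('b, 'd) monoid_scheme \<Rightarrow> (('a + 'b) list \<times> ('a + 'b) list) set"
  for G :: "('a, 'c) monoid_scheme" and H :: "('b, 'd) monoid_scheme" where
  refl: "w \<in> free_product_words G H \<Longrightarrow> (w, w) \<in> free_product_rel G H"
| sym: "(v, w) \<in> free_product_rel G H \<Longrightarrow> (w, v) \<in> free_product_rel G H"
| trans: "(u, v) \<in> free_product_rel G H \<Longrightarrow> (v, w) \<in> free_product_rel G H \<Longrightarrow>
    (u, w) \<in> free_product_rel G H"
| one_left: "u \<in> free_product_words G H \<Longrightarrow> v \<in> free_product_words G H \<Longrightarrow>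
    (u @ [Inl \<one>\<^bsub>G\<^esub>] @ v, u @ v) \<in> free_product_rel G H"
| one_right: "u \<in> free_product_words G H \<Longrightarrow> v \<in> free_product_words G H \<Longrightarrow>
    (u @ [Inr \<one>\<^bsub>H\<^esub>] @ v, u @ v) \<in> free_product_rel G H"
| mult_left: "u \<in> free_product_words G H \<Longrightarrow> v \<in> free_product_words G H \<Longrightarrow>
    a \<in> carrier G \<Longrightarrow> b \<in> carrier G \<Longrightarrow>
    (u @ [Inl a, Inl b] @ v, u @ [Inl (a \<otimes>\<^bsub>G\<^esub> b)] @ v) \<in> free_product_rel G H"
| mult_right: "u \<in> free_product_words G H \<Longrightarrow> v \<in> free_product_words G H \<Longrightarrow>
    a \<in> carrier H \<Longrightarrow> b \<in> carrier H \<Longrightarrow>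
    (u @ [Inr a, Inr b] @ v, u @ [Inr (a \<otimes>\<^bsub>H\<^esub> b)] @ v) \<in> free_product_rel G H"

definition free_product ::
    "('a, 'c) monoid_scheme \<Rightarrow> ('b, 'd) monoid_scheme \<Rightarrow> ('a + 'b) list set monoid" where
  "free_product G H =
    \<lparr>carrier = free_product_words G H // free_product_rel G H,
     monoid.mult = (\<lambda>A B. \<Union>u\<in>A. \<Union>v\<in>B. free_product_rel G H `` {u @ v}),
     one = free_product_rel G H `` {[]}\<rparr>"

lemma free_product_rel_carrier:
  assumes "(v, w) \<in> free_product_rel G H" "group G" "group H"
  shows "v \<in> free_product_words G H" "w \<in> free_product_words G H"
proof -
  interpret G: group G by fact
  interpret H: group H by fact
  from assms(1) show "v \<in> free_product_words G H" "w \<in> free_product_words G H"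
    by (induction) auto
qed

lemma free_product_rel_append:
  assumes "(v, w) \<in> free_product_rel G H" "x \<in> free_product_words G H"
    "y \<in> free_product_words G H"
  shows "(x @ v @ y, x @ w @ y) \<in> free_product_rel G H"
  using assms
proof (induction)
  case (one_left u v)
  then show ?case using free_product_rel.one_left[of "x @ u" G H "v @ y"] by simp
next
  case (one_right u v)
  then show ?case using free_product_rel.one_right[of "x @ u" G H "v @ y"] by simp
next
  case (mult_left u v a b)
  then show ?case using free_product_rel.mult_left[of "x @ u" G H "v @ y" a b] by simp
next
  case (mult_right u v a b)
  then show ?case using free_product_rel.mult_right[of "x @ u" G H "v @ y" a b] by simp
next
  case (trans u v w)
  then show ?case by (blast intro: free_product_rel.trans)
next
  case (refl w)
  then show ?case by (intro free_product_rel.refl) simp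
qed (auto intro: free_product_rel.sym)

lemma equiv_free_product_rel:
  assumes "group G" "group H"
  shows "equiv (free_product_words G H) (free_product_rel G H)"
proof (rule equivI)
  show "free_product_rel G H \<subseteq>
      free_product_words G H \<times> free_product_words G H"
    using free_product_rel_carrier[OF _ assms] by fast
qed (auto intro: refl_onI symI transI free_product_rel.intros(1-3))

lemma free_product_mult_class:
  assumes "group G" "group H"
    and u: "u \<in> free_product_words G H" and v: "v \<in> free_product_words G H"
  shows "free_product_rel G H `` {u} \<otimes>\<^bsub>free_product G H\<^esub> free_product_rel G H `` {v} =
    free_product_rel G H `` {u @ v}"
proof -
  let ?R = "free_product_rel G H"
  note eq = equiv_free_product_rel[OF assms(1,2)]
  have "congruent2 ?R ?R (\<lambda>u v. ?R `` {u @ v})"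
  proof (rule congruent2I[OF eq eq])
    fix x y z assume "(x, y) \<in> ?R" and z: "z \<in> free_product_words G H"
    from free_product_rel_append[OF this(1), of "[]" z] z
    show "?R `` {x @ z} = ?R `` {y @ z}" by (intro equiv_class_eq[OF eq]) simp
    from free_product_rel_append[OF \<open>(x, y) \<in> ?R\<close>, of z "[]"] z
    show "?R `` {z @ x} = ?R `` {z @ y}" by (intro equiv_class_eq[OF eq]) simp
  qed
  from UN_equiv_class2[OF eq eq this u v] show ?thesis
    by (simp add: free_product_def)
qed

lemma group_free_product:
  assumes "group G" "group H"
  shows "group (free_product G H)"
proof (rule groupI)
  interpret G: group G by fact
  interpret H: group H by fact
  let ?R = "free_product_rel G H" and ?S = "free_product_words G H"
  note mc = free_product_mult_class[OF assms] and eq = equiv_free_product_rel[OF assms]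
  have car: "carrier (free_product G H) = ?S // ?R" by (simp add: free_product_def)
  have one: "\<one>\<^bsub>free_product G H\<^esub> = ?R `` {[]}" by (simp add: free_product_def)
  show "\<one>\<^bsub>free_product G H\<^esub> \<in> carrier (free_product G H)"
    by (simp add: one car quotientI)
  fix A assume A: "A \<in> carrier (free_product G H)"
  then obtain x where x: "A = ?R `` {x}" "x \<in> ?S" unfolding car by (rule quotientE)
  show "\<one>\<^bsub>free_product G H\<^esub> \<otimes>\<^bsub>free_product G H\<^esub> A = A"
    using x mc[of "[]" x] by (simp add: one)
  have "\<exists>y\<in>?S. (y @ x, []) \<in> ?R"
    using x(2)
  proof (induction x)
    case Nil
    then show ?case by (auto intro: free_product_rel.refl)
  next
    case (Cons c x)
    then obtain y where y: "y \<in> ?S" "(y @ x, []) \<in> ?R" by auto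
    from Cons have c: "c \<in> Sum_Type.Plus (carrier G) (carrier H)" and x: "x \<in> ?S" by auto
    have "\<exists>d\<in>Sum_Type.Plus (carrier G) (carrier H). (y @ [d, c] @ x, y @ x) \<in> ?R"
      using c
    proof
      fix a assume a: "c = Inl a" "a \<in> carrier G"
      have "(y @ [Inl (inv\<^bsub>G\<^esub> a), c] @ x, y @ x) \<in> ?R"
        using free_product_rel.mult_left[of y G H x "inv\<^bsub>G\<^esub> a" a]
          free_product_rel.one_left[of y G H x] a x y(1)
        by (auto intro: free_product_rel.trans)
      with a show ?thesis by blast
    next
      fix a assume a: "c = Inr a" "a \<in> carrier H"
      have "(y @ [Inr (inv\<^bsub>H\<^esub> a), c] @ x, y @ x) \<in> ?R"
        using free_product_rel.mult_right[of y G H x "inv\<^bsub>H\<^esub> a" a]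
          free_product_rel.one_right[of y G H x] a x y(1)
        by (auto intro: free_product_rel.trans)
      with a show ?thesis by blast
    qed
    then obtain d where d: "d \<in> Sum_Type.Plus (carrier G) (carrier H)"
        "(y @ [d, c] @ x, y @ x) \<in> ?R" by blast
    then have "((y @ [d]) @ c # x, []) \<in> ?R"
      using y(2) by (auto intro: free_product_rel.trans)
    moreover have "y @ [d] \<in> ?S" using y(1) d(1) by simp
    ultimately show ?case by blast
  qed
  then obtain y where y: "y \<in> ?S" "(y @ x, []) \<in> ?R" by blast
  have "?R `` {y} \<otimes>\<^bsub>free_product G H\<^esub> A = \<one>\<^bsub>free_product G H\<^esub>"
    using mc[OF y(1) x(2)] equiv_class_eq[OF eq y(2)] by (simp add: x(1) one)
  with y(1) show "\<exists>B\<in>carrier (free_product G H).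
      B \<otimes>\<^bsub>free_product G H\<^esub> A = \<one>\<^bsub>free_product G H\<^esub>"
    unfolding car by (blast intro: quotientI)
  fix B assume "B \<in> carrier (free_product G H)"
  then obtain y where y: "B = ?R `` {y}" "y \<in> ?S" unfolding car by (rule quotientE)
  have xy: "x @ y \<in> ?S" using x(2) y(2) by simp
  show "A \<otimes>\<^bsub>free_product G H\<^esub> B \<in> carrier (free_product G H)"
    using mc[OF x(2) y(2)] xy by (simp only: x(1) y(1) car quotientI)
  fix C assume "C \<in> carrier (free_product G H)"
  then obtain z where z: "C = ?R `` {z}" "z \<in> ?S" unfolding car by (rule quotientE)
  have yz: "y @ z \<in> ?S" using z(2) y(2) by simp
  show "A \<otimes>\<^bsub>free_product G H\<^esub> B \<otimes>\<^bsub>free_product G H\<^esub> C =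
      A \<otimes>\<^bsub>free_product G H\<^esub> (B \<otimes>\<^bsub>free_product G H\<^esub> C)"
    by (simp only: x(1) y(1) z(1) mc[OF x(2) y(2)] mc[OF y(2) z(2)] mc[OF xy z(2)]
        mc[OF x(2) yz] append_assoc)
qed

lemma free_product_universal:
  assumes "group G" "group H" "group K" and f: "f \<in> hom G K" and g: "g \<in> hom H K"
  shows "\<exists>h\<in>hom (free_product G H) K.
    (\<forall>a\<in>carrier G. h (free_product_rel G H `` {[Inl a]}) = f a) \<and>
    (\<forall>b\<in>carrier H. h (free_product_rel G H `` {[Inr b]}) = g b)"
proof -
  interpret G: group G by fact
  interpret H: group H by fact
  interpret K: group K by fact
  interpret f: group_hom G K f by unfold_locales (fact f)
  interpret g: group_hom H K g by unfold_locales (fact g)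
  let ?R = "free_product_rel G H" and ?S = "free_product_words G H"
  note mc = free_product_mult_class[OF assms(1,2)] and eq = equiv_free_product_rel[OF assms(1,2)]
  have car: "carrier (free_product G H) = ?S // ?R" by (simp add: free_product_def)
  define e where "e w = foldr (\<lambda>c k. case_sum f g c \<otimes>\<^bsub>K\<^esub> k) w \<one>\<^bsub>K\<^esub>" for w
  have e_Nil: "e [] = \<one>\<^bsub>K\<^esub>" and e_Cons: "e (c # w) = case_sum f g c \<otimes>\<^bsub>K\<^esub> e w" for c w
    by (simp_all add: e_def)
  have e_closed: "e w \<in> carrier K" if "w \<in> ?S" for w
    using that by (induction w) (auto simp: e_Nil e_Cons)
  have e_append: "e (v @ w) = e v \<otimes>\<^bsub>K\<^esub> e w" if "v \<in> ?S" "w \<in> ?S" for v w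
    using that(1)
  proof (induction v)
    case (Cons c v)
    have "case_sum f g c \<in> carrier K" using Cons(1) by auto
    with Cons show ?case
      using e_closed[of v] e_closed[OF that(2)] by (simp add: e_Cons K.m_assoc)
  qed (simp add: e_Nil e_closed[OF that(2)])
  have e_cong: "e v = e w" if "(v, w) \<in> ?R" for v w
    using that
  proof induction
    case (mult_left u v a b)
    then have "e ([Inl a, Inl b] @ v) = e ([Inl (a \<otimes>\<^bsub>G\<^esub> b)] @ v)"
      using e_closed[of v] by (simp add: e_Cons K.m_assoc)
    with mult_left show ?case by (subst (1 2) e_append) auto
  next
    case (mult_right u v a b)
    then have "e ([Inr a, Inr b] @ v) = e ([Inr (a \<otimes>\<^bsub>H\<^esub> b)] @ v)"
      using e_closed[of v] by (simp add: e_Cons K.m_assoc)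
    with mult_right show ?case by (subst (1 2) e_append) auto
  next
    case (one_left u v)
    then have "e ([Inl \<one>\<^bsub>G\<^esub>] @ v) = e v" using e_closed[of v] by (simp add: e_Cons)
    with one_left show ?case by (subst (1 2) e_append) auto
  next
    case (one_right u v)
    then have "e ([Inr \<one>\<^bsub>H\<^esub>] @ v) = e v" using e_closed[of v] by (simp add: e_Cons)
    with one_right show ?case by (subst (1 2) e_append) auto
  qed simp_all
  define h where "h A = the_elem (e ` A)" for A
  have h_class: "h (?R `` {w}) = e w" if w: "w \<in> ?S" for w
  proof -
    have "e ` (?R `` {w}) = {e w}"
    proof (intro equalityI subsetI)
      fix k assume "k \<in> e ` (?R `` {w})"
      then obtain v where "(w, v) \<in> ?R" "k = e v" by blast
      then show "k \<in> {e w}" using e_cong[of w v] by simp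
    next
      fix k assume "k \<in> {e w}"
      then show "k \<in> e ` (?R `` {w})" using free_product_rel.refl[OF w] by blast
    qed
    then show ?thesis by (simp add: h_def)
  qed
  have "h \<in> hom (free_product G H) K"
  proof (rule homI)
    fix A assume "A \<in> carrier (free_product G H)"
    then obtain x where x: "A = ?R `` {x}" "x \<in> ?S" unfolding car by (rule quotientE)
    then show "h A \<in> carrier K" by (simp only: h_class e_closed)
    fix B assume "B \<in> carrier (free_product G H)"
    then obtain y where y: "B = ?R `` {y}" "y \<in> ?S" unfolding car by (rule quotientE)
    have "x @ y \<in> ?S" using x(2) y(2) by simp
    then show "h (A \<otimes>\<^bsub>free_product G H\<^esub> B) = h A \<otimes>\<^bsub>K\<^esub> h B"
      by (simp only: x(1) y(1) mc[OF x(2) y(2)] h_class[OF x(2)] h_class[OF y(2)]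
          h_class[of "x @ y"] e_append[OF x(2) y(2)])
  qed
  moreover have "h (?R `` {[Inl a]}) = f a" if "a \<in> carrier G" for a
    using that by (subst h_class) (auto simp: e_Nil e_Cons)
  moreover have "h (?R `` {[Inr b]}) = g b" if "b \<in> carrier H" for b
    using that by (subst h_class) (auto simp: e_Nil e_Cons)
  ultimately show ?thesis by blast
qed

definition hecke_group :: "nat \<Rightarrow> (int + int) list set monoid" where
  "hecke_group q = free_product (integer_mod_group 2) (integer_mod_group q)"

definition subgroup_number :: "nat \<Rightarrow> ('a, 'b) monoid_scheme \<Rightarrow> nat" where
  "subgroup_number n \<Gamma> =
    card {H. subgroup H \<Gamma> \<and> finite (rcosets\<^bsub>\<Gamma>\<^esub> H) \<and> card (rcosets\<^bsub>\<Gamma>\<^esub> H) = n}"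

definition subgroup_series :: "('a, 'b) monoid_scheme \<Rightarrow> int fps" where
  "subgroup_series \<Gamma> = Abs_fps (\<lambda>n. int (subgroup_number (n + 1) \<Gamma>))"

text \<open>
  Laurent series in \<open>z\<^sup>1\<^sup>/\<^sup>3\<close> are represented by \<^typ>\<open>int fls\<close>, the formal variable standing
  for \<open>z\<^sup>1\<^sup>/\<^sup>3\<close>: \<open>zroot k\<close> is \<open>z\<^sup>k\<^sup>/\<^sup>3\<close>, \<open>zpow k\<close> is \<open>z\<^sup>k\<close>,
  and \<open>in_z f\<close> is the power series \<open>f(z)\<close>.
\<close>

abbreviation zroot :: "int \<Rightarrow> int fls" where
  "zroot k \<equiv> fls_X_intpow k"

abbreviation zpow :: "int \<Rightarrow> int fls" where
  "zpow k \<equiv> zroot (3 * k)"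

abbreviation in_z :: "int fps \<Rightarrow> int fls" where
  "in_z f \<equiv> fls_compose_power (fps_to_fls f) 3"

text \<open>
  The exponents \<open>4 ^ n\<close> are pairwise distinct, so every coefficient of
  \<open>\<Phi>\<^sub>2(z) = \<Sum>\<^sub>n z\<^bsup>4 ^ n / 3\<^esup>\<close> is 0 or 1.
\<close>

definition Phi2 :: "int fls" where
  "Phi2 = fps_to_fls (Abs_fps (\<lambda>k. if \<exists>n. k = 4 ^ n then 1 else 0))"

definition fls_cong :: "int fls \<Rightarrow> int fls \<Rightarrow> int \<Rightarrow> bool" where
  "fls_cong f g m \<longleftrightarrow> (\<forall>k. [fls_nth f k = fls_nth g k] (mod m))"

end

theory Submission
  imports Defs "HOL-Library.Numeral_Type"
begin

text \<open>
  Let \<open>t\<^sub>n\<close> and \<open>f\<^sub>n\<close> count the homomorphisms from the cyclic groups of orders 2 and 5 to the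
  symmetric group of degree \<open>n\<close>, and let \<open>M\<^sub>k(z) = \<Sum>\<^sub>n t\<^bsub>n+k\<^esub> f\<^sub>n z\<^sup>n / n!\<close>. Hall's recursion says
  \<open>z M\<^sub>0' = z S M\<^sub>0\<close> for the series \<open>S\<close> of the subgroup numbers. Put \<open>m\<^sub>k = M\<^sub>k / M\<^sub>0\<close>,
  \<open>T = z S\<close> and \<open>\<theta> = z d/dz\<close>. The recurrence of \<open>t\<close> gives
  \<open>m\<^bsub>k+2\<^esub> = \<theta> m\<^sub>k + m\<^bsub>k+1\<^esub> + (k + 1) m\<^sub>k + m\<^sub>k T\<close>, in particular \<open>m\<^sub>2 = m\<^sub>1 + 1 + T\<close>, and that of \<open>f\<close>
  gives \<open>m\<^sub>1 = 1 + z + z\<^sup>5 m\<^sub>4\<close> and \<open>m\<^sub>2 = 1 + (1 + z) m\<^sub>1 + z\<^sup>5 m\<^sub>5\<close>. Because of the factors \<open>z\<^sup>5\<close> this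
  quadratic system has exactly one solution, over the integers as well as modulo 16.

  It remains to exhibit a solution modulo 16 whose \<open>T\<close> is \<open>z\<close> times the claimed expression. With
  \<open>w\<^sup>3 = z\<close> and \<open>\<Phi> = \<Phi>\<^sub>2\<close>, the series \<open>F = \<Phi>\<^sup>4 - \<Phi> + w\<close> is divisible by 2, so a polynomial in \<open>w\<close> and
  \<open>\<Phi>\<close> vanishes modulo 16 as soon as its expansion in powers of the monic polynomial \<open>F\<close> has coefficients
  divisible by 16, 8, 4, 2, 1 at \<open>1, F, F\<^sup>2, F\<^sup>3, F\<^sup>4\<close>; and \<open>w d\<Phi>/dw = w + 4 w\<^sup>4\<close> modulo 16.
\<close>

section \<open>Permutation actions and subgroup numbers\<close>

text \<open>Homomorphisms to the symmetric group on \<open>U\<close>. Extensionality outside the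
  carrier gives each of them exactly one representing function, so that \<open>card\<close> counts
  homomorphisms.\<close>

definition actions :: "('a, 'b) monoid_scheme \<Rightarrow> 'c set \<Rightarrow> ('a \<Rightarrow> 'c \<Rightarrow> 'c) set" where
  "actions G U = {\<phi> \<in> PiE (carrier G) (\<lambda>_. {p. p permutes U}).
     \<forall>g\<in>carrier G. \<forall>h\<in>carrier G. \<phi> (g \<otimes>\<^bsub>G\<^esub> h) = \<phi> g \<circ> \<phi> h}"

definition action_orbit :: "('a, 'b) monoid_scheme \<Rightarrow> ('a \<Rightarrow> 'c \<Rightarrow> 'c) \<Rightarrow> 'c \<Rightarrow> 'c set" where
  "action_orbit G \<phi> x = (\<lambda>g. \<phi> g x) ` carrier G"

definition action_stabilizer :: "('a, 'b) monoid_scheme \<Rightarrow> ('a \<Rightarrow> 'c \<Rightarrow> 'c) \<Rightarrow> 'c \<Rightarrow> 'a set" where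
  "action_stabilizer G \<phi> x = {g \<in> carrier G. \<phi> g x = x}"

text \<open>Transitivity is expressed through the orbit of a base point \<open>x\<close>, whose
  stabilizer is the subgroup attached to the action.\<close>

definition transitive_actions ::
    "('a, 'b) monoid_scheme \<Rightarrow> 'c set \<Rightarrow> 'c \<Rightarrow> ('a \<Rightarrow> 'c \<Rightarrow> 'c) set" where
  "transitive_actions G U x = {\<phi> \<in> actions G U. action_orbit G \<phi> x = U}"

lemma actionsD:
  assumes "\<phi> \<in> actions G U"
  shows "\<phi> \<in> extensional (carrier G)"
    and "g \<in> carrier G \<Longrightarrow> \<phi> g permutes U"
    and "g \<in> carrier G \<Longrightarrow> h \<in> carrier G \<Longrightarrow> \<phi> (g \<otimes>\<^bsub>G\<^esub> h) = \<phi> g \<circ> \<phi> h"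
  using assms by (auto simp: actions_def PiE_def)

lemma actionsI:
  assumes "\<phi> \<in> extensional (carrier G)"
    and "\<And>g. g \<in> carrier G \<Longrightarrow> \<phi> g permutes U"
    and "\<And>g h. g \<in> carrier G \<Longrightarrow> h \<in> carrier G \<Longrightarrow> \<phi> (g \<otimes>\<^bsub>G\<^esub> h) = \<phi> g \<circ> \<phi> h"
  shows "\<phi> \<in> actions G U"
  using assms by (auto simp: actions_def PiE_def)

context group
begin

lemma action_one:
  assumes "\<phi> \<in> actions G U"
  shows "\<phi> \<one> = id"
proof -
  have "\<phi> \<one> = \<phi> \<one> \<circ> \<phi> \<one>"
    using actionsD(3)[OF assms, of \<one> \<one>] by simp
  moreover have "inj (\<phi> \<one>)"
    using actionsD(2)[OF assms one_closed] by (rule permutes_inj)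
  ultimately show ?thesis
    by (metis comp_apply id_apply injD ext)
qed

lemma action_inv:
  assumes "\<phi> \<in> actions G U" "g \<in> carrier G"
  shows "\<phi> g (\<phi> (inv g) y) = y" "\<phi> (inv g) (\<phi> g y) = y"
  using actionsD(3)[OF assms(1), of g "inv g"] actionsD(3)[OF assms(1), of "inv g" g] assms(2)
  by (metis action_one[OF assms(1)] comp_apply id_apply inv_closed r_inv l_inv)+

lemma action_mult:
  assumes "\<phi> \<in> actions G U" "g \<in> carrier G" "h \<in> carrier G"
  shows "\<phi> (g \<otimes> h) y = \<phi> g (\<phi> h y)"
  using actionsD(3)[OF assms] by simp

lemma action_orbit_self: "\<phi> \<in> actions G U \<Longrightarrow> x \<in> action_orbit G \<phi> x"
  unfolding action_orbit_def by (rule image_eqI[of _ _ \<one>]) (simp_all add: action_one)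

lemma action_orbit_subset: "\<phi> \<in> actions G U \<Longrightarrow> x \<in> U \<Longrightarrow> action_orbit G \<phi> x \<subseteq> U"
  by (auto simp: action_orbit_def actionsD(2) permutes_in_image)

text \<open>Invertibility of \<open>g\<close> gives both directions, so the complement of an orbit
  is invariant as well and the action can be split there.\<close>

lemma action_orbit_invariant:
  assumes "\<phi> \<in> actions G U" "g \<in> carrier G"
  shows "\<phi> g y \<in> action_orbit G \<phi> x \<longleftrightarrow> y \<in> action_orbit G \<phi> x"
proof
  assume "y \<in> action_orbit G \<phi> x"
  then obtain h where "h \<in> carrier G" "y = \<phi> h x" by (auto simp: action_orbit_def)
  with assms show "\<phi> g y \<in> action_orbit G \<phi> x"
    unfolding action_orbit_def by (intro image_eqI[of _ _ "g \<otimes> h"]) (simp_all add: action_mult)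
next
  assume "\<phi> g y \<in> action_orbit G \<phi> x"
  then obtain h where "h \<in> carrier G" "\<phi> g y = \<phi> h x" by (auto simp: action_orbit_def)
  then have "y = \<phi> (inv g \<otimes> h) x"
    using assms by (metis action_inv(2) action_mult inv_closed)
  with \<open>h \<in> carrier G\<close> assms show "y \<in> action_orbit G \<phi> x"
    unfolding action_orbit_def by (intro image_eqI[of _ _ "inv g \<otimes> h"]) simp_all
qed

section \<open>Splitting an action along an orbit\<close>

text \<open>Continuing by the identity off \<open>Y\<close> keeps all actions on the same type of
  points, so that actions on disjoint subsets can be composed.\<close>

definition restrict_action :: "('a \<Rightarrow> 'c \<Rightarrow> 'c) \<Rightarrow> 'c set \<Rightarrow> 'a \<Rightarrow> 'c \<Rightarrow> 'c" where
  "restrict_action \<phi> Y = (\<lambda>g\<in>carrier G. \<lambda>y. if y \<in> Y then \<phi> g y else y)"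

lemma restrict_action:
  assumes "\<phi> \<in> actions G U" "Y \<subseteq> U" "\<And>g y. g \<in> carrier G \<Longrightarrow> \<phi> g y \<in> Y \<longleftrightarrow> y \<in> Y"
  shows "restrict_action \<phi> Y \<in> actions G Y"
proof (rule actionsI)
  fix g assume g: "g \<in> carrier G"
  have "bij_betw (restrict_action \<phi> Y g) Y Y"
    by (rule bij_betw_byWitness[where f' = "\<phi> (inv g)"])
      (use g assms action_inv[OF assms(1) g] in \<open>auto simp: restrict_action_def\<close>)
  then show "restrict_action \<phi> Y g permutes Y"
    by (rule bij_imp_permutes) (simp add: restrict_action_def g)
next
  fix g h assume "g \<in> carrier G" "h \<in> carrier G"
  then show "restrict_action \<phi> Y (g \<otimes> h) = restrict_action \<phi> Y g \<circ> restrict_action \<phi> Y h"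
    using assms(3) by (auto simp: restrict_action_def fun_eq_iff action_mult[OF assms(1)])
qed (simp add: restrict_action_def)

text \<open>Each point is moved by at most one of the two actions, so their composition is the
  disjoint union of the actions.\<close>

lemma glue_action:
  assumes \<phi>: "\<phi> \<in> actions G Y" and \<psi>: "\<psi> \<in> actions G Z" and "Y \<inter> Z = {}"
  shows "(\<lambda>g\<in>carrier G. \<phi> g \<circ> \<psi> g) \<in> actions G (Y \<union> Z)"
    and "g \<in> carrier G \<Longrightarrow> y \<in> Y \<Longrightarrow> \<phi> g (\<psi> g y) = \<phi> g y"
    and "g \<in> carrier G \<Longrightarrow> y \<notin> Y \<Longrightarrow> \<phi> g (\<psi> g y) = \<psi> g y"
proof -
  note p = actionsD(2)[OF \<phi>] actionsD(2)[OF \<psi>]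
  show Y: "\<phi> g (\<psi> g y) = \<phi> g y" if "g \<in> carrier G" "y \<in> Y" for g y
    using that assms(3) permutes_not_in[OF p(2)] by (metis disjoint_iff)
  show nY: "\<phi> g (\<psi> g y) = \<psi> g y" if "g \<in> carrier G" "y \<notin> Y" for g y
    using that assms(3) permutes_not_in[OF p(1)] permutes_not_in[OF p(2)] permutes_in_image[OF p(2)]
    by (metis disjoint_iff)
  show "(\<lambda>g\<in>carrier G. \<phi> g \<circ> \<psi> g) \<in> actions G (Y \<union> Z)"
  proof (rule actionsI)
    fix g assume g: "g \<in> carrier G"
    have "\<phi> g permutes Y \<union> Z" "\<psi> g permutes Y \<union> Z"
      using p[OF g] by (auto intro: permutes_subset)
    then show "(\<lambda>g\<in>carrier G. \<phi> g \<circ> \<psi> g) g permutes Y \<union> Z"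
      using g by (simp add: permutes_compose)
  next
    fix g h assume gh: "g \<in> carrier G" "h \<in> carrier G"
    have "\<phi> (g \<otimes> h) (\<psi> (g \<otimes> h) y) = \<phi> g (\<psi> g (\<phi> h (\<psi> h y)))" for y
    proof (cases "y \<in> Y")
      case True
      then have "\<phi> h y \<in> Y" using p(1)[OF gh(2)] by (simp add: permutes_in_image)
      with True gh show ?thesis by (simp add: Y action_mult[OF \<phi>])
    next
      case False
      have "\<psi> h y \<notin> Y"
      proof (cases "y \<in> Z")
        case True
        then have "\<psi> h y \<in> Z" using p(2)[OF gh(2)] by (simp add: permutes_in_image)
        with assms(3) show ?thesis by auto
      next
        case False
        with \<open>y \<notin> Y\<close> show ?thesis using permutes_not_in[OF p(2)[OF gh(2)]] by simp
      qed
      with False gh nY[OF m_closed[OF gh] False] show ?thesis by (simp add: nY action_mult[OF \<psi>])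
    qed
    with gh show "(\<lambda>g\<in>carrier G. \<phi> g \<circ> \<psi> g) (g \<otimes> h) =
        (\<lambda>g\<in>carrier G. \<phi> g \<circ> \<psi> g) g \<circ> (\<lambda>g\<in>carrier G. \<phi> g \<circ> \<psi> g) h"
      by (auto simp: fun_eq_iff)
  qed simp
qed

text \<open>Both the orbit and its complement are invariant, and gluing inverts the pair of
  restrictions; only the part on the orbit has to be transitive.\<close>

lemma bij_betw_actions_with_orbit:
  assumes "x \<in> Y" "Y \<subseteq> U"
  shows "bij_betw (\<lambda>\<phi>. (restrict_action \<phi> Y, restrict_action \<phi> (U - Y)))
    {\<phi> \<in> actions G U. action_orbit G \<phi> x = Y} (transitive_actions G Y x \<times> actions G (U - Y))"
proof (rule bij_betw_byWitness[where f' = "\<lambda>(\<phi>, \<psi>). \<lambda>g\<in>carrier G. \<phi> g \<circ> \<psi> g"])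
  let ?L = "{\<phi> \<in> actions G U. action_orbit G \<phi> x = Y}"
  have inv: "\<phi> g y \<in> Y \<longleftrightarrow> y \<in> Y" "\<phi> g y \<in> U \<longleftrightarrow> y \<in> U" "\<phi> g permutes U"
    if "\<phi> \<in> ?L" "g \<in> carrier G" for \<phi> g y
    using that action_orbit_invariant[of \<phi> U g y x] actionsD(2)[of \<phi> G U g]
    by (auto simp: permutes_in_image)
  show "\<forall>\<phi>\<in>?L. (\<lambda>(\<phi>, \<psi>). \<lambda>g\<in>carrier G. \<phi> g \<circ> \<psi> g)
      (restrict_action \<phi> Y, restrict_action \<phi> (U - Y)) = \<phi>"
  proof
    fix \<phi> assume \<phi>: "\<phi> \<in> ?L"
    have "(\<lambda>g\<in>carrier G. restrict_action \<phi> Y g \<circ> restrict_action \<phi> (U - Y) g) = \<phi>"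
    proof (rule extensionalityI[of _ "carrier G"])
      fix g assume g: "g \<in> carrier G"
      have "restrict_action \<phi> Y g (restrict_action \<phi> (U - Y) g y) = \<phi> g y" for y
        using inv(1)[OF \<phi> g, of y] permutes_not_in[OF inv(3)[OF \<phi> g], of y] assms(2) g
        by (auto simp: restrict_action_def)
      then show "(\<lambda>g\<in>carrier G. restrict_action \<phi> Y g \<circ> restrict_action \<phi> (U - Y) g) g = \<phi> g"
        using g by (simp add: fun_eq_iff)
    qed (use \<phi> actionsD(1) in auto)
    then show "(\<lambda>(\<phi>, \<psi>). \<lambda>g\<in>carrier G. \<phi> g \<circ> \<psi> g)
      (restrict_action \<phi> Y, restrict_action \<phi> (U - Y)) = \<phi>" by simp
  qed
  show "(\<lambda>\<phi>. (restrict_action \<phi> Y, restrict_action \<phi> (U - Y))) ` ?L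
      \<subseteq> transitive_actions G Y x \<times> actions G (U - Y)"
  proof clarify
    fix \<phi> assume \<phi>: "\<phi> \<in> actions G U" "Y = action_orbit G \<phi> x"
    then have L: "\<phi> \<in> ?L" by simp
    have "restrict_action \<phi> Y \<in> actions G Y" "restrict_action \<phi> (U - Y) \<in> actions G (U - Y)"
      using inv[OF L] assms(2) by (auto intro!: restrict_action[OF \<phi>(1)])
    moreover have "action_orbit G (restrict_action \<phi> Y) x = action_orbit G \<phi> x"
      using assms(1) by (auto simp: action_orbit_def restrict_action_def)
    ultimately show "restrict_action \<phi> (action_orbit G \<phi> x) \<in> transitive_actions G (action_orbit G \<phi> x) x \<and>
        restrict_action \<phi> (U - action_orbit G \<phi> x) \<in> actions G (U - action_orbit G \<phi> x)"
      using \<phi>(2) by (simp add: transitive_actions_def)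
  qed
  have glue: "(\<lambda>g\<in>carrier G. \<phi> g \<circ> \<psi> g) \<in> actions G U"
      "g \<in> carrier G \<Longrightarrow> y \<in> Y \<Longrightarrow> \<phi> g (\<psi> g y) = \<phi> g y"
      "g \<in> carrier G \<Longrightarrow> y \<notin> Y \<Longrightarrow> \<phi> g (\<psi> g y) = \<psi> g y"
    if "\<phi> \<in> transitive_actions G Y x" "\<psi> \<in> actions G (U - Y)" for \<phi> \<psi> g y
  proof -
    have "Y \<union> (U - Y) = U" using assms(2) by auto
    then show "(\<lambda>g\<in>carrier G. \<phi> g \<circ> \<psi> g) \<in> actions G U"
      "g \<in> carrier G \<Longrightarrow> y \<in> Y \<Longrightarrow> \<phi> g (\<psi> g y) = \<phi> g y"
      "g \<in> carrier G \<Longrightarrow> y \<notin> Y \<Longrightarrow> \<phi> g (\<psi> g y) = \<psi> g y"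
      using that glue_action[of \<phi> Y \<psi> "U - Y"] by (auto simp: transitive_actions_def)
  qed
  show "(\<lambda>(\<phi>, \<psi>). \<lambda>g\<in>carrier G. \<phi> g \<circ> \<psi> g) ` (transitive_actions G Y x \<times> actions G (U - Y)) \<subseteq> ?L"
  proof clarify
    fix \<phi> \<psi> assume h: "\<phi> \<in> transitive_actions G Y x" "\<psi> \<in> actions G (U - Y)"
    have "action_orbit G (\<lambda>g\<in>carrier G. \<phi> g \<circ> \<psi> g) x = action_orbit G \<phi> x"
      unfolding action_orbit_def using glue(2)[OF h _ assms(1)] by (intro image_cong) simp_all
    with h glue(1)[OF h]
    show "(\<lambda>g\<in>carrier G. \<phi> g \<circ> \<psi> g) \<in> actions G U \<and>
        action_orbit G (\<lambda>g\<in>carrier G. \<phi> g \<circ> \<psi> g) x = Y"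
      by (simp add: transitive_actions_def)
  qed
  show "\<forall>p\<in>transitive_actions G Y x \<times> actions G (U - Y).
      (\<lambda>\<phi>. (restrict_action \<phi> Y, restrict_action \<phi> (U - Y)))
        ((\<lambda>(\<phi>, \<psi>). \<lambda>g\<in>carrier G. \<phi> g \<circ> \<psi> g) p) = p"
  proof clarify
    fix \<phi> \<psi> assume h: "\<phi> \<in> transitive_actions G Y x" "\<psi> \<in> actions G (U - Y)"
    then have \<phi>: "\<phi> \<in> actions G Y" by (simp add: transitive_actions_def)
    show "restrict_action (\<lambda>g\<in>carrier G. \<phi> g \<circ> \<psi> g) Y = \<phi> \<and>
        restrict_action (\<lambda>g\<in>carrier G. \<phi> g \<circ> \<psi> g) (U - Y) = \<psi>"
    proof (intro conjI extensionalityI[of _ "carrier G"])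
      fix g assume g: "g \<in> carrier G"
      note out = permutes_not_in[OF actionsD(2)[OF \<phi> g]] permutes_not_in[OF actionsD(2)[OF h(2) g]]
      show "restrict_action (\<lambda>g\<in>carrier G. \<phi> g \<circ> \<psi> g) Y g = \<phi> g"
        using g glue(2)[OF h g] out by (auto simp: restrict_action_def fun_eq_iff)
      show "restrict_action (\<lambda>g\<in>carrier G. \<phi> g \<circ> \<psi> g) (U - Y) g = \<psi> g"
        using g glue(3)[OF h g] out by (auto simp: restrict_action_def fun_eq_iff)
    qed (use actionsD(1)[OF \<phi>] actionsD(1)[OF h(2)] in \<open>auto simp: restrict_action_def\<close>)
  qed
qed

section \<open>Stabilizers, cosets and the number of transitive actions\<close>

lemma subgroup_action_stabilizer:
  assumes "\<phi> \<in> actions G U"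
  shows "subgroup (action_stabilizer G \<phi> x) G"
proof (rule subgroupI)
  show "action_stabilizer G \<phi> x \<noteq> {}"
    using action_one[OF assms] by (auto simp: action_stabilizer_def)
  show "inv g \<in> action_stabilizer G \<phi> x" if "g \<in> action_stabilizer G \<phi> x" for g
    using that action_inv(2)[OF assms, of g x] by (auto simp: action_stabilizer_def)
qed (auto simp: action_stabilizer_def action_mult[OF assms])

lemma action_eq_iff_stabilizer:
  assumes "\<phi> \<in> actions G U" "g \<in> carrier G" "h \<in> carrier G"
  shows "\<phi> g x = \<phi> h x \<longleftrightarrow> inv g \<otimes> h \<in> action_stabilizer G \<phi> x"
proof -
  have "\<phi> g x = \<phi> h x \<longleftrightarrow> \<phi> (inv g) (\<phi> h x) = x"
    using action_inv[OF assms(1,2)] by metis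
  with assms show ?thesis by (simp add: action_stabilizer_def action_mult[OF assms(1)])
qed

lemma rcos_mem_iff:
  assumes "subgroup H G" "g \<in> carrier G" "h \<in> carrier G"
  shows "h \<in> H #> g \<longleftrightarrow> h \<otimes> inv g \<in> H"
proof
  assume "h \<in> H #> g"
  then obtain k where "k \<in> H" "h = k \<otimes> g" by (auto simp: r_coset_def)
  then show "h \<otimes> inv g \<in> H"
    using subgroup.mem_carrier[OF assms(1)] assms(2) by (simp add: m_assoc)
next
  assume *: "h \<otimes> inv g \<in> H"
  have "h = (h \<otimes> inv g) \<otimes> g" using assms by (simp add: m_assoc)
  with * show "h \<in> H #> g" unfolding r_coset_def by blast
qed

text \<open>Points correspond to left cosets of the stabilizer; passing to inverses turns these into
  the right cosets that \<open>subgroup_number\<close> counts. Hence the stabilizer has index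
  \<open>card U\<close>.\<close>

lemma bij_betw_rcosets_stabilizer:
  assumes \<phi>: "\<phi> \<in> transitive_actions G U x"
  shows "bij_betw (\<lambda>y. {g \<in> carrier G. \<phi> (inv g) x = y}) U (rcosets (action_stabilizer G \<phi> x))"
    (is "bij_betw ?f U (rcosets ?H)")
proof -
  have act: "\<phi> \<in> actions G U" and orb: "action_orbit G \<phi> x = U"
    using \<phi> by (auto simp: transitive_actions_def)
  have coset: "?H #> h = ?f (\<phi> (inv h) x)" if h: "h \<in> carrier G" for h
  proof -
    have "g \<in> ?H #> h \<longleftrightarrow> g \<in> ?f (\<phi> (inv h) x)" if g: "g \<in> carrier G" for g
      using action_eq_iff_stabilizer[OF act, of "inv g" "inv h" x] g h
      by (simp add: rcos_mem_iff[OF subgroup_action_stabilizer[OF act] h g])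
    moreover have "?H #> h \<subseteq> carrier G"
      using h by (intro r_coset_subset_G) (auto simp: action_stabilizer_def)
    ultimately show ?thesis by blast
  qed
  have reach: "\<exists>h\<in>carrier G. y = \<phi> (inv h) x" if "y \<in> U" for y
  proof -
    from that orb obtain g where "g \<in> carrier G" "y = \<phi> g x"
      by (auto simp: action_orbit_def)
    then show ?thesis by (intro bexI[of _ "inv g"]) simp_all
  qed
  show ?thesis
  proof (rule bij_betw_imageI)
    show "inj_on ?f U"
    proof (rule inj_onI)
      fix y z assume "y \<in> U" "z \<in> U" "?f y = ?f z"
      with reach[of y] show "y = z" by blast
    qed
    have "?f y \<in> rcosets ?H" if y: "y \<in> U" for y
    proof -
      from reach[OF y] obtain h where "h \<in> carrier G" "y = \<phi> (inv h) x" by blast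
      with coset[of h] show ?thesis by (auto simp: RCOSETS_def)
    qed
    moreover have "A \<in> ?f ` U" if "A \<in> rcosets ?H" for A
    proof -
      from that obtain h where h: "h \<in> carrier G" "A = ?H #> h" by (auto simp: RCOSETS_def)
      have "\<phi> (inv h) x \<in> U" using h(1) orb by (auto simp: action_orbit_def)
      with coset[OF h(1)] h(2) show ?thesis by blast
    qed
    ultimately show "?f ` U = rcosets ?H" by blast
  qed
qed

text \<open>The group acts transitively on the right cosets of \<open>H\<close>, and the point
  \<open>H\<close> has stabilizer \<open>H\<close>. This action is carried to \<open>U\<close> by a
  bijection that sends \<open>H\<close> to \<open>x\<close>.\<close>

lemma ex_action_with_stabilizer:
  assumes H: "subgroup H G" and fin: "finite (rcosets H)" "finite U" and card: "card (rcosets H) = card U"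
    and x: "x \<in> U"
  shows "\<exists>\<phi>\<in>transitive_actions G U x. action_stabilizer G \<phi> x = H"
proof -
  have HG: "H \<subseteq> carrier G" by (rule subgroup.subset[OF H])
  have Hin: "H \<in> rcosets H" using subgroup.subgroup_in_rcosets[OF H is_group] .
  \<comment> \<open>The bijection is first chosen away from \<open>H\<close> and \<open>x\<close>,
    so that it can then be made to send \<open>H\<close> to \<open>x\<close>.\<close>
  have "card (rcosets H - {H}) = card (U - {x})"
    using card Hin x fin by simp
  with fin obtain \<beta>0 where \<beta>0: "bij_betw \<beta>0 (rcosets H - {H}) (U - {x})"
    using finite_same_card_bij by (metis finite_Diff)
  define \<beta> where "\<beta> = \<beta>0(H := x)"
  have \<beta>H: "\<beta> H = x" by (simp add: \<beta>_def)
  have "bij_betw \<beta> (rcosets H - {H}) (U - {x})"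
    using \<beta>0 by (subst bij_betw_cong[of _ \<beta> \<beta>0]) (auto simp: \<beta>_def)
  then have "bij_betw \<beta> ((rcosets H - {H}) \<union> {H}) ((U - {x}) \<union> {\<beta> H})"
    by (rule notIn_Un_bij_betw[rotated 2]) (simp_all add: \<beta>H)
  then have \<beta>: "bij_betw \<beta> (rcosets H) U"
    using Hin x by (simp add: \<beta>H insert_absorb)
  define \<gamma> where "\<gamma> = inv_into (rcosets H) \<beta>"
  have \<gamma>: "bij_betw \<gamma> U (rcosets H)" unfolding \<gamma>_def by (rule bij_betw_inv_into[OF \<beta>])
  have \<beta>\<gamma>: "\<beta> (\<gamma> y) = y" if "y \<in> U" for y
    using that bij_betw_inv_into_right[OF \<beta>] by (simp add: \<gamma>_def)
  have \<gamma>\<beta>: "\<gamma> (\<beta> A) = A" if "A \<in> rcosets H" for A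
    using that bij_betw_inv_into_left[OF \<beta>] by (simp add: \<gamma>_def)
  have \<gamma>U: "\<gamma> y \<in> rcosets H" if "y \<in> U" for y using \<gamma> that by (rule bij_betwE[rule_format])
  have \<beta>R: "\<beta> A \<in> U" if "A \<in> rcosets H" for A using \<beta> that by (rule bij_betwE[rule_format])
  have shift: "A #> g \<in> rcosets H" "A #> g #> h = A #> (g \<otimes> h)" "A #> \<one> = A"
    if "A \<in> rcosets H" "g \<in> carrier G" "h \<in> carrier G" for A g h
  proof -
    from that(1) obtain k where k: "k \<in> carrier G" "A = H #> k" by (auto simp: RCOSETS_def)
    then have A: "A \<subseteq> carrier G" using HG by (simp add: r_coset_subset_G)
    show "A #> g \<in> rcosets H"
      using k that HG by (auto simp: coset_mult_assoc RCOSETS_def)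
    show "A #> g #> h = A #> (g \<otimes> h)" "A #> \<one> = A"
      using A that by (simp_all add: coset_mult_assoc)
  qed
  \<comment> \<open>Right multiplication by the inverse is a left action.\<close>
  define \<phi> where "\<phi> = (\<lambda>g\<in>carrier G. \<lambda>y. if y \<in> U then \<beta> (\<gamma> y #> inv g) else y)"
  have \<phi>U: "\<phi> g y = \<beta> (\<gamma> y #> inv g)" if "g \<in> carrier G" "y \<in> U" for g y
    using that by (simp add: \<phi>_def)
  have \<phi>_in: "\<phi> g y \<in> U" if "g \<in> carrier G" "y \<in> U" for g y
    using that by (simp add: \<phi>U \<beta>R shift(1) \<gamma>U)
  have mult: "\<phi> (g \<otimes> h) y = \<phi> g (\<phi> h y)" if "g \<in> carrier G" "h \<in> carrier G" for g h y
  proof (cases "y \<in> U")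
    case True
    with that \<phi>_in[OF that(2) True] show ?thesis
      by (simp add: \<phi>U \<gamma>\<beta> shift \<gamma>U inv_mult_group)
  qed (use that in \<open>simp add: \<phi>_def\<close>)
  have one: "\<phi> \<one> y = y" if "y \<in> U" for y
    using that by (simp add: \<phi>U shift(3)[of _ \<one> \<one>] \<gamma>U \<beta>\<gamma>)
  have act: "\<phi> \<in> actions G U"
  proof (rule actionsI)
    fix g assume g: "g \<in> carrier G"
    have "bij_betw (\<phi> g) U U"
      by (rule bij_betw_byWitness[where f' = "\<phi> (inv g)"])
        (use g \<phi>_in in \<open>auto simp: one simp flip: mult\<close>)
    then show "\<phi> g permutes U"
      by (rule bij_imp_permutes) (simp add: \<phi>_def g)
  qed (auto simp: fun_eq_iff mult, simp add: \<phi>_def)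
  have \<phi>x: "\<phi> g x = \<beta> (H #> inv g)" if "g \<in> carrier G" for g
    using that x \<gamma>\<beta>[OF Hin] by (simp add: \<phi>U \<beta>H)
  have "y \<in> action_orbit G \<phi> x" if y: "y \<in> U" for y
  proof -
    from \<gamma>U[OF y] obtain g where g: "g \<in> carrier G" "\<gamma> y = H #> g" by (auto simp: RCOSETS_def)
    then have "\<phi> (inv g) x = y" using \<beta>\<gamma>[OF y] by (simp add: \<phi>x)
    with g(1) show ?thesis by (force simp: action_orbit_def)
  qed
  then have "action_orbit G \<phi> x = U"
    using action_orbit_subset[OF act x] by blast
  moreover have "action_stabilizer G \<phi> x = H"
  proof -
    have "\<phi> g x = x \<longleftrightarrow> g \<in> H" if g: "g \<in> carrier G" for g
    proof -
      have "\<phi> g x = x \<longleftrightarrow> \<beta> (H #> inv g) = \<beta> H" by (simp add: \<phi>x g \<beta>H)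
      also have "\<dots> \<longleftrightarrow> H #> inv g = H"
        using \<gamma>\<beta> Hin shift(1)[OF Hin, of "inv g"] g by (metis inv_closed)
      also have "\<dots> \<longleftrightarrow> inv g \<in> H"
        using coset_join1[OF _ _ H, of "inv g"] coset_join2[OF _ H, of "inv g"] g by blast
      also have "\<dots> \<longleftrightarrow> g \<in> H"
        using subgroup.m_inv_closed[OF H] g by (metis inv_inv)
      finally show ?thesis .
    qed
    with HG show ?thesis by (auto simp: action_stabilizer_def)
  qed
  ultimately show ?thesis using act by (auto simp: transitive_actions_def)
qed

text \<open>The map that should send \<open>\<phi> g x\<close> to \<open>\<psi> g x\<close>. Equal
  stabilizers make the choice of \<open>g\<close> immaterial.\<close>

definition action_transport ::
    "'c set \<Rightarrow> 'c \<Rightarrow> ('a \<Rightarrow> 'c \<Rightarrow> 'c) \<Rightarrow> ('a \<Rightarrow> 'c \<Rightarrow> 'c) \<Rightarrow> 'c \<Rightarrow> 'c" where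
  "action_transport U x \<phi> \<psi> y =
     (if y \<in> U then \<psi> (SOME g. g \<in> carrier G \<and> \<phi> g x = y) x else y)"

lemma action_transport_orbit:
  assumes "\<phi> \<in> transitive_actions G U x" "\<psi> \<in> transitive_actions G U x"
    "action_stabilizer G \<phi> x = action_stabilizer G \<psi> x" "g \<in> carrier G"
  shows "action_transport U x \<phi> \<psi> (\<phi> g x) = \<psi> g x"
proof -
  have act: "\<phi> \<in> actions G U" "\<psi> \<in> actions G U" and orb: "action_orbit G \<phi> x = U"
    using assms by (auto simp: transitive_actions_def)
  define h where "h = (SOME h. h \<in> carrier G \<and> \<phi> h x = \<phi> g x)"
  have h: "h \<in> carrier G \<and> \<phi> h x = \<phi> g x"
    unfolding h_def by (rule someI[of _ g]) (simp add: assms(4))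
  then have "\<psi> h x = \<psi> g x"
    using action_eq_iff_stabilizer[OF act(1), of h g x] action_eq_iff_stabilizer[OF act(2), of h g x]
      assms(3,4) by simp
  moreover have "\<phi> g x \<in> U" using assms(4) orb by (auto simp: action_orbit_def)
  ultimately show ?thesis by (simp add: action_transport_def h_def)
qed

text \<open>Both actions are isomorphic to the action on the cosets of the common stabilizer. The
  transports in the two directions are mutually inverse, fix \<open>x\<close> and intertwine the
  actions.\<close>

lemma actions_same_stabilizer_conjugate:
  assumes \<phi>: "\<phi> \<in> transitive_actions G U x" and \<psi>: "\<psi> \<in> transitive_actions G U x"
    and stab: "action_stabilizer G \<phi> x = action_stabilizer G \<psi> x" and x: "x \<in> U"
  shows "\<exists>\<pi>. \<pi> permutes (U - {x}) \<and> (\<forall>g\<in>carrier G. \<psi> g = \<pi> \<circ> \<phi> g \<circ> inv_into UNIV \<pi>)"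
proof -
  have act: "\<phi> \<in> actions G U" "\<psi> \<in> actions G U"
    and orb: "action_orbit G \<phi> x = U" "action_orbit G \<psi> x = U"
    using \<phi> \<psi> by (auto simp: transitive_actions_def)
  have reach: "\<exists>g\<in>carrier G. y = \<phi> g x" "\<exists>g\<in>carrier G. y = \<psi> g x" if "y \<in> U" for y
    using that orb by (auto simp: action_orbit_def)
  have inU: "\<phi> g x \<in> U" "\<psi> g x \<in> U" if "g \<in> carrier G" for g
    using that orb by (auto simp: action_orbit_def)
  define \<pi> where "\<pi> = action_transport U x \<phi> \<psi>"
  define \<rho> where "\<rho> = action_transport U x \<psi> \<phi>"
  have \<pi>: "\<pi> (\<phi> g x) = \<psi> g x" and \<rho>: "\<rho> (\<psi> g x) = \<phi> g x" if "g \<in> carrier G" for g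
    using that stab action_transport_orbit[OF \<phi> \<psi>] action_transport_orbit[OF \<psi> \<phi>]
    by (auto simp: \<pi>_def \<rho>_def)
  have "bij_betw \<pi> U U"
  proof (rule bij_betw_byWitness[where f' = \<rho>])
    show "\<forall>y\<in>U. \<rho> (\<pi> y) = y" "\<pi> ` U \<subseteq> U"
      using reach(1) inU(2) by (auto dest!: reach(1) simp: \<pi> \<rho>)
    show "\<forall>y\<in>U. \<pi> (\<rho> y) = y" "\<rho> ` U \<subseteq> U"
      using inU(1) by (auto dest!: reach(2) simp: \<pi> \<rho>)
  qed
  then have "\<pi> permutes U"
    by (rule bij_imp_permutes) (simp add: \<pi>_def action_transport_def)
  moreover have "\<pi> x = x"
    using \<pi>[OF one_closed] by (simp add: action_one[OF act(1)] action_one[OF act(2)])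
  ultimately have perm: "\<pi> permutes (U - {x})"
    by (auto intro: permutes_superset)
  have "\<psi> g = \<pi> \<circ> \<phi> g \<circ> inv_into UNIV \<pi>" if g: "g \<in> carrier G" for g
  proof -
    have "\<psi> g (\<pi> y) = \<pi> (\<phi> g y)" for y
    proof (cases "y \<in> U")
      case True
      then obtain h where h: "h \<in> carrier G" "y = \<phi> h x" using reach(1) by blast
      then show ?thesis
        using g \<pi>[OF m_closed[OF g h(1)]] by (simp add: \<pi> action_mult[OF act(1)] action_mult[OF act(2)])
    next
      case False
      then show ?thesis
        using permutes_not_in[OF actionsD(2)[OF act(1) g]] permutes_not_in[OF actionsD(2)[OF act(2) g]]
        by (simp add: \<pi>_def action_transport_def)
    qed
    then have "\<psi> g y = \<pi> (\<phi> g (inv_into UNIV \<pi> y))" for y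
      using permutes_inverses(1)[OF perm] by metis
    then show ?thesis by (simp add: fun_eq_iff)
  qed
  with perm show ?thesis by blast
qed

text \<open>Conjugation by the permutations of \<open>U - {x}\<close> is simply transitive on these
  actions: any two of them are conjugate, and \<open>\<pi>\<close> is recovered from
  \<open>c \<pi> g x = \<pi> (\<phi> g x)\<close>.\<close>

lemma card_transitive_actions_with_stabilizer:
  assumes \<phi>: "\<phi> \<in> transitive_actions G U x" and x: "x \<in> U" and fin: "finite U"
  shows "card {\<psi> \<in> transitive_actions G U x. action_stabilizer G \<psi> x = action_stabilizer G \<phi> x} =
    fact (card U - 1)"
proof -
  have act: "\<phi> \<in> actions G U" and orb: "action_orbit G \<phi> x = U"
    using \<phi> by (auto simp: transitive_actions_def)
  define c where "c \<pi> = (\<lambda>g\<in>carrier G. \<pi> \<circ> \<phi> g \<circ> inv_into UNIV \<pi>)" for \<pi> :: "'c \<Rightarrow> 'c"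
  let ?P = "{\<pi>. \<pi> permutes (U - {x})}"
  let ?F = "{\<psi> \<in> transitive_actions G U x. action_stabilizer G \<psi> x = action_stabilizer G \<phi> x}"
  have fix_x: "\<pi> x = x" "inv_into UNIV \<pi> x = x" if "\<pi> \<in> ?P" for \<pi>
    using that permutes_not_in[of \<pi> "U - {x}" x] permutes_not_in[OF permutes_inv, of \<pi> "U - {x}" x]
    by auto
  have cx: "c \<pi> g x = \<pi> (\<phi> g x)" if "\<pi> \<in> ?P" "g \<in> carrier G" for \<pi> g
    using that fix_x[OF that(1)] by (simp add: c_def)
  have inj: "inj_on c ?P"
  proof (rule inj_onI)
    fix \<pi> \<rho> assume *: "\<pi> \<in> ?P" "\<rho> \<in> ?P" "c \<pi> = c \<rho>"
    have "\<pi> y = \<rho> y" for y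
    proof (cases "y \<in> U")
      case True
      with orb obtain g where "g \<in> carrier G" "y = \<phi> g x" by (auto simp: action_orbit_def)
      with * show ?thesis using cx by metis
    next
      case False
      with *(1,2) show ?thesis
        by (metis Diff_iff mem_Collect_eq permutes_not_in)
    qed
    then show "\<pi> = \<rho>" by (rule ext)
  qed
  have "c ` ?P = ?F"
  proof (intro equalityI subsetI)
    fix \<psi> assume "\<psi> \<in> c ` ?P"
    then obtain \<pi> where \<pi>: "\<pi> \<in> ?P" "\<psi> = c \<pi>" by blast
    then have perm: "\<pi> permutes U" "\<pi> permutes (U - {x})" by (auto intro: permutes_subset)
    have "\<psi> \<in> actions G U"
    proof (rule actionsI)
      fix g assume "g \<in> carrier G"
      then show "\<psi> g permutes U"
        using perm(1) actionsD(2)[OF act] by (simp add: \<pi>(2) c_def permutes_compose permutes_inv)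
    next
      fix g h assume "g \<in> carrier G" "h \<in> carrier G"
      then show "\<psi> (g \<otimes> h) = \<psi> g \<circ> \<psi> h"
        using permutes_inverses(2)[OF perm(1)]
        by (simp add: \<pi>(2) c_def fun_eq_iff action_mult[OF act])
    qed (simp add: \<pi>(2) c_def)
    moreover have "action_orbit G \<psi> x = \<pi> ` action_orbit G \<phi> x"
      using cx[OF \<pi>(1)] by (auto simp: action_orbit_def \<pi>(2) image_image)
    moreover have "\<pi> ` U = U" by (rule permutes_image[OF perm(1)])
    moreover have "\<pi> (\<phi> g x) = x \<longleftrightarrow> \<phi> g x = x" for g
      using fix_x(1)[OF \<pi>(1)] permutes_inj[OF perm(1)] by (metis injD)
    then have "action_stabilizer G \<psi> x = action_stabilizer G \<phi> x"
      using cx[OF \<pi>(1)] fix_x(1)[OF \<pi>(1)] by (auto simp: action_stabilizer_def \<pi>(2))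
    ultimately show "\<psi> \<in> ?F" by (simp add: transitive_actions_def orb)
  next
    fix \<psi> assume \<psi>: "\<psi> \<in> ?F"
    then obtain \<pi> where \<pi>: "\<pi> \<in> ?P" "\<forall>g\<in>carrier G. \<psi> g = \<pi> \<circ> \<phi> g \<circ> inv_into UNIV \<pi>"
      using actions_same_stabilizer_conjugate[OF \<phi>, of \<psi>] x by auto
    have "\<psi> = c \<pi>"
      using \<psi> \<pi>(2) by (intro extensionalityI[of _ "carrier G"])
        (auto simp: c_def transitive_actions_def actionsD(1))
    with \<pi>(1) show "\<psi> \<in> c ` ?P" by blast
  qed
  with card_image[OF inj] have "card ?F = card ?P" by simp
  also have "\<dots> = fact (card U - 1)"
    using fin x by (simp add: card_permutations)
  finally show ?thesis .
qed

text \<open>Taking the stabilizer of \<open>x\<close> maps the transitive actions onto the subgroups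
  of index \<open>card U\<close>, and every fibre has \<open>fact (card U - 1)\<close>
  elements.\<close>

lemma card_transitive_actions:
  assumes fin: "finite (actions G U)" "finite U" and x: "x \<in> U"
  shows "card (transitive_actions G U x) = fact (card U - 1) * subgroup_number (card U) G"
proof -
  let ?T = "transitive_actions G U x"
  let ?S = "{H. subgroup H G \<and> finite (rcosets H) \<and> card (rcosets H) = card U}"
  have finT: "finite ?T"
    using fin(1) by (rule finite_subset[rotated]) (auto simp: transitive_actions_def)
  have S: "?S = (\<lambda>\<phi>. action_stabilizer G \<phi> x) ` ?T"
  proof (intro equalityI subsetI)
    fix H assume "H \<in> ?S"
    then show "H \<in> (\<lambda>\<phi>. action_stabilizer G \<phi> x) ` ?T"
      using ex_action_with_stabilizer[of H U x] fin(2) x by auto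
  next
    fix H assume "H \<in> (\<lambda>\<phi>. action_stabilizer G \<phi> x) ` ?T"
    then obtain \<phi> where \<phi>: "\<phi> \<in> ?T" "H = action_stabilizer G \<phi> x" by blast
    with bij_betw_rcosets_stabilizer[OF \<phi>(1)] fin(2) show "H \<in> ?S"
      by (auto simp: transitive_actions_def subgroup_action_stabilizer
          dest: bij_betw_finite bij_betw_same_card)
  qed
  have "card ?T = (\<Sum>H\<in>?S. card {\<psi> \<in> ?T. action_stabilizer G \<psi> x = H})"
    unfolding S using finT by (subst card_eq_sum, subst sum.image_gen[of _ _ "\<lambda>\<phi>. action_stabilizer G \<phi> x"]) simp_all
  also have "\<dots> = (\<Sum>H\<in>?S. fact (card U - 1))"
  proof (rule sum.cong[OF HOL.refl])
    fix H assume "H \<in> ?S"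
    then obtain \<phi> where "\<phi> \<in> ?T" "H = action_stabilizer G \<phi> x" unfolding S by blast
    then show "card {\<psi> \<in> ?T. action_stabilizer G \<psi> x = H} = fact (card U - 1)"
      using card_transitive_actions_with_stabilizer[OF _ x fin(2)] by simp
  qed
  finally show ?thesis by (simp add: subgroup_number_def)
qed

end

section \<open>Hall's recursion\<close>

lemma sum_Pow_card:
  fixes F :: "nat \<Rightarrow> nat"
  assumes "finite A"
  shows "(\<Sum>Y\<in>Pow A. F (card Y)) = (\<Sum>j\<le>card A. (card A choose j) * F j)"
proof -
  have "(\<Sum>Y\<in>Pow A. F (card Y)) = (\<Sum>j\<le>card A. \<Sum>Y | Y \<in> Pow A \<and> card Y = j. F (card Y))"
    using assms by (intro sum.group[symmetric]) (auto intro: card_mono)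
  also have "\<dots> = (\<Sum>j\<le>card A. \<Sum>Y | Y \<in> Pow A \<and> card Y = j. F j)"
    by (intro sum.cong) auto
  also have "\<dots> = (\<Sum>j\<le>card A. (card A choose j) * F j)"
    using assms by (simp add: n_subsets Pow_def)
  finally show ?thesis .
qed

definition action_number :: "('a, 'b) monoid_scheme \<Rightarrow> nat \<Rightarrow> nat" where
  "action_number G n = card (actions G {..<n})"

context group
begin

text \<open>The actions are sorted by the orbit \<open>insert x Y\<close> of \<open>x\<close>; each
  class consists of pairs of a transitive action on the orbit and an action on the
  complement.\<close>

lemma card_actions_orbit_sum:
  assumes fin: "\<And>Y :: 'c set. finite Y \<Longrightarrow> finite (actions G Y)"
    and U: "finite U" and x: "(x :: 'c) \<in> U"
  shows "card (actions G U) = (\<Sum>Y\<in>Pow (U - {x}).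
    fact (card Y) * subgroup_number (Suc (card Y)) G * card (actions G (U - insert x Y)))"
proof -
  have "actions G U = (\<Union>Y\<in>Pow (U - {x}). {\<phi> \<in> actions G U. action_orbit G \<phi> x = insert x Y})"
  proof (intro equalityI subsetI)
    fix \<phi> assume \<phi>: "\<phi> \<in> actions G U"
    then have "action_orbit G \<phi> x = insert x (action_orbit G \<phi> x - {x})"
      "action_orbit G \<phi> x - {x} \<in> Pow (U - {x})"
      using action_orbit_self[OF \<phi>] action_orbit_subset[OF \<phi> x] by auto
    with \<phi> show "\<phi> \<in> (\<Union>Y\<in>Pow (U - {x}). {\<phi> \<in> actions G U. action_orbit G \<phi> x = insert x Y})"
      by blast
  qed auto
  then have "card (actions G U) =
      card (\<Union>Y\<in>Pow (U - {x}). {\<phi> \<in> actions G U. action_orbit G \<phi> x = insert x Y})" by simp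
  also have "\<dots> = (\<Sum>Y\<in>Pow (U - {x}). card {\<phi> \<in> actions G U. action_orbit G \<phi> x = insert x Y})"
  proof (rule card_UN_disjoint)
    show "\<forall>Y\<in>Pow (U - {x}). finite {\<phi> \<in> actions G U. action_orbit G \<phi> x = insert x Y}"
      using fin[OF U] by simp
    show "\<forall>Y\<in>Pow (U - {x}). \<forall>Z\<in>Pow (U - {x}). Y \<noteq> Z \<longrightarrow>
        {\<phi> \<in> actions G U. action_orbit G \<phi> x = insert x Y} \<inter>
        {\<phi> \<in> actions G U. action_orbit G \<phi> x = insert x Z} = {}"
      by (auto dest: insert_ident[THEN iffD1, rotated 2])
  qed (simp add: U)
  also have "\<dots> = (\<Sum>Y\<in>Pow (U - {x}).
      fact (card Y) * subgroup_number (Suc (card Y)) G * card (actions G (U - insert x Y)))"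
  proof (rule sum.cong[OF HOL.refl])
    fix Y assume Y: "Y \<in> Pow (U - {x})"
    then have "finite Y" using U by (auto intro: finite_subset)
    with Y have "finite (insert x Y)" "card (insert x Y) = Suc (card Y)" "insert x Y \<subseteq> U"
      using x by (auto simp: card_insert_if)
    then show "card {\<phi> \<in> actions G U. action_orbit G \<phi> x = insert x Y} =
        fact (card Y) * subgroup_number (Suc (card Y)) G * card (actions G (U - insert x Y))"
      using bij_betw_same_card[OF bij_betw_actions_with_orbit[of x "insert x Y" U]]
        card_transitive_actions[of "insert x Y" x] fin
      by (simp add: card_cartesian_product)
  qed
  finally show ?thesis .
qed

text \<open>The orbit recursion removes at least the base point, so by induction its right-hand side
  depends on \<open>card U\<close> alone.\<close>

lemma card_actions:
  fixes U :: "nat set"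
  assumes fin: "\<And>Y :: nat set. finite Y \<Longrightarrow> finite (actions G Y)"
  shows "finite U \<Longrightarrow> card (actions G U) = action_number G (card U)"
proof (induction "card U" arbitrary: U rule: less_induct)
  case less
  show ?case
  proof (cases "U = {}")
    case False
    then obtain x where x: "x \<in> U" by blast
    \<comment> \<open>Stated for every set of the size of \<open>U\<close>, because it is applied
      both to \<open>U\<close> and to \<open>{..<card U}\<close>.\<close>
    have rec: "card (actions G V) = (\<Sum>Y\<in>Pow (V - {x}).
        fact (card Y) * subgroup_number (Suc (card Y)) G * action_number G (card U - Suc (card Y)))"
      if V: "finite V" "card V = card U" "x \<in> V" for V :: "nat set" and x
    proof (rule HOL.trans[OF card_actions_orbit_sum[OF fin V(1,3)] sum.cong[OF HOL.refl]])
      fix Y assume Y: "Y \<in> Pow (V - {x})"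
      then have "finite Y" using V(1) by (auto intro: finite_subset)
      with Y have "card (V - insert x Y) = card U - Suc (card Y)"
        using V by (subst card_Diff_subset) (auto simp: card_insert_if)
      moreover have "card V > 0" using V(1,3) by (simp only: card_gt_0_iff) blast
      ultimately show "fact (card Y) * subgroup_number (Suc (card Y)) G * card (actions G (V - insert x Y)) =
          fact (card Y) * subgroup_number (Suc (card Y)) G * action_number G (card U - Suc (card Y))"
        using less.hyps[of "V - insert x Y"] V by simp
    qed
    have n: "card U > 0" using False less.prems by (simp add: card_gt_0_iff)
    have "action_number G (card U) = (\<Sum>Y\<in>Pow ({..<card U} - {0}).
        fact (card Y) * subgroup_number (Suc (card Y)) G * action_number G (card U - Suc (card Y)))"
      using rec[of "{..<card U}" 0] n by (simp add: action_number_def)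
    also have "\<dots> = (\<Sum>Y\<in>Pow (U - {x}).
        fact (card Y) * subgroup_number (Suc (card Y)) G * action_number G (card U - Suc (card Y)))"
    proof -
      define F where "F k = fact k * subgroup_number (Suc k) G * action_number G (card U - Suc k)" for k
      show ?thesis
        using sum_Pow_card[of "U - {x}" F] sum_Pow_card[of "{..<card U} - {0}" F] x n less.prems
        by (simp add: F_def)
    qed
    also have "\<dots> = card (actions G U)"
      using rec[OF less.prems HOL.refl x] by simp
    finally show ?thesis ..
  qed (simp add: action_number_def)
qed

text \<open>The base point is \<open>0\<close>, and \<open>n choose j\<close> counts the possible
  orbits of \<open>0\<close> with \<open>Suc j\<close> points among \<open>Suc n\<close>
  points.\<close>

lemma action_number_Suc:
  assumes fin: "\<And>Y :: nat set. finite Y \<Longrightarrow> finite (actions G Y)"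
  shows "action_number G (Suc n) =
    (\<Sum>j\<le>n. (n choose j) * (fact j * subgroup_number (Suc j) G * action_number G (n - j)))"
proof -
  have "action_number G (Suc n) = (\<Sum>Y\<in>Pow ({..<Suc n} - {0}).
      fact (card Y) * subgroup_number (Suc (card Y)) G * action_number G (n - card Y))"
  proof -
    have "action_number G (Suc n) = (\<Sum>Y\<in>Pow ({..<Suc n} - {0}).
        fact (card Y) * subgroup_number (Suc (card Y)) G * card (actions G ({..<Suc n} - insert 0 Y)))"
      unfolding action_number_def by (rule card_actions_orbit_sum[OF fin]) simp_all
    also have "\<dots> = (\<Sum>Y\<in>Pow ({..<Suc n} - {0}).
        fact (card Y) * subgroup_number (Suc (card Y)) G * action_number G (n - card Y))"
    proof (rule sum.cong[OF HOL.refl])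
      fix Y :: "nat set" assume Y: "Y \<in> Pow ({..<Suc n} - {0})"
      then have "finite Y" by (auto intro: finite_subset)
      with Y have "card ({..<Suc n} - insert 0 Y) = n - card Y"
        by (subst card_Diff_subset) (auto simp: card_insert_if)
      then show "fact (card Y) * subgroup_number (Suc (card Y)) G * card (actions G ({..<Suc n} - insert 0 Y)) =
          fact (card Y) * subgroup_number (Suc (card Y)) G * action_number G (n - card Y)"
        using card_actions[OF fin, of "{..<Suc n} - insert 0 Y"] by simp
    qed
    finally show ?thesis .
  qed
  also have "\<dots> = (\<Sum>j\<le>n. (n choose j) * (fact j * subgroup_number (Suc j) G * action_number G (n - j)))"
    by (subst sum_Pow_card[where F = "\<lambda>j. fact j * subgroup_number (Suc j) G * action_number G (n - j)"])
      simp_all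
  finally show ?thesis .
qed

lemma action_number_0: "action_number G 0 = 1"
proof -
  have "actions G ({} :: nat set) = {\<lambda>g\<in>carrier G. id}"
    by (auto simp: actions_def PiE_def extensional_def fun_eq_iff Pi_def)
  then show ?thesis by (simp add: action_number_def)
qed

end

section \<open>Cyclic groups and free products\<close>

lemma finite_actions_finite_group:
  assumes "finite (carrier G)" "finite U"
  shows "finite (actions G U)"
proof (rule finite_subset)
  show "actions G U \<subseteq> PiE (carrier G) (\<lambda>_. {p. p permutes U})"
    by (auto simp: actions_def)
  show "finite (PiE (carrier G) (\<lambda>_. {p. p permutes U}))"
    using assms by (intro finite_PiE) (auto intro: finite_permutations)
qed

text \<open>By Lagrange's theorem only the trivial subgroup and the whole group occur.\<close>

lemma (in group) subgroup_number_prime_order: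
  assumes "Coset.order G = p" "Factorial_Ring.prime p"
  shows "subgroup_number k G = (if k = 1 \<or> k = p then 1 else 0)"
proof -
  have fin: "finite (carrier G)"
    using assms prime_gt_0_nat[OF assms(2)] card_gt_0_iff[of "carrier G"] by (simp add: Coset.order_def)
  have lagr: "card (rcosets H) * card H = p" if "subgroup H G" for H
    using lagrange[OF that] assms(1) by simp
  have fr: "finite (rcosets H)" for H
    using fin by (simp add: RCOSETS_def)
  have sub: "H = carrier G \<or> H = {\<one>}" if H: "subgroup H G" for H
  proof -
    from lagr[OF H] have "card H = 1 \<or> card H = p"
      using assms(2) by (metis dvd_triv_right prime_nat_iff)
    then show ?thesis
    proof
      assume "card H = 1"
      then show ?thesis using subgroup.one_closed[OF H] by (auto simp: card_1_singleton_iff)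
    next
      assume "card H = p"
      then show ?thesis
        using card_subset_eq[OF fin subgroup.subset[OF H]] assms(1) by (simp add: Coset.order_def)
    qed
  qed
  have G: "subgroup (carrier G) G" "card (rcosets (carrier G)) = 1"
  proof -
    show "subgroup (carrier G) G" by (rule subgroup_self)
    from lagr[OF this] show "card (rcosets (carrier G)) = 1"
      using assms prime_gt_0_nat[OF assms(2)] by (simp add: Coset.order_def)
  qed
  have 1: "subgroup {\<one>} G" "card (rcosets {\<one>}) = p"
  proof -
    show "subgroup {\<one>} G" by (rule triv_subgroup)
    from lagr[OF this] show "card (rcosets {\<one>}) = p" by simp
  qed
  have "p \<noteq> 1" using assms(2) by auto
  then have "{H. subgroup H G \<and> finite (rcosets H) \<and> card (rcosets H) = k} =
      (if k = 1 then {carrier G} else if k = p then {{\<one>}} else {})" (is "?S k = _")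
  proof -
    have "H \<in> ?S k \<longleftrightarrow> (H = carrier G \<and> k = 1) \<or> (H = {\<one>} \<and> k = p)" for H
    proof
      assume "H \<in> ?S k"
      then have "subgroup H G" "card (rcosets H) = k" by simp_all
      with sub[of H] G(2) 1(2) show "(H = carrier G \<and> k = 1) \<or> (H = {\<one>} \<and> k = p)" by blast
    next
      assume "(H = carrier G \<and> k = 1) \<or> (H = {\<one>} \<and> k = p)"
      then show "H \<in> ?S k" using G 1 fr by blast
    qed
    with \<open>p \<noteq> 1\<close> show ?thesis by (simp add: set_eq_iff)
  qed
  then show ?thesis by (simp add: subgroup_number_def)
qed

text \<open>Hall's recursion read backwards: the subgroup numbers are known, and only the indices
  \<open>1\<close> and \<open>p\<close> contribute, that is, the summands \<open>j = 0\<close> and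
  \<open>j = p - 1\<close>.\<close>

lemma action_number_cyclic_prime:
  assumes "Factorial_Ring.prime p"
  defines "h \<equiv> action_number (integer_mod_group p)"
  shows "h 0 = 1" "h (Suc n) = h n + (if p \<le> Suc n then (n choose (p - 1)) * (fact (p - 1) * h (Suc n - p)) else 0)"
proof -
  have p: "p > 1" by (rule prime_gt_1_nat[OF assms(1)])
  interpret group "integer_mod_group p" by (rule group_integer_mod_group)
  have fin: "finite (carrier (integer_mod_group p))" and ord: "Coset.order (integer_mod_group p) = p"
    using p by (auto simp: carrier_integer_mod_group Coset.order_def)
  show "h 0 = 1" unfolding h_def by (rule action_number_0)
  have "h (Suc n) = (\<Sum>j\<le>n. (n choose j) * (fact j * (if Suc j = 1 \<or> Suc j = p then 1 else 0) * h (n - j)))"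
    unfolding h_def
    by (subst action_number_Suc) (simp_all only: finite_actions_finite_group[OF fin] subgroup_number_prime_order[OF ord assms(1)])
  also have "\<dots> = (\<Sum>j\<le>n. (if j = 0 then h n else 0) +
      (if j = p - 1 then (n choose (p - 1)) * (fact (p - 1) * h (Suc n - p)) else 0))"
    using p by (intro sum.cong) auto
  also have "\<dots> = h n + (if p - 1 \<le> n then (n choose (p - 1)) * (fact (p - 1) * h (Suc n - p)) else 0)"
    by (simp add: sum.distrib)
  finally show "h (Suc n) = h n + (if p \<le> Suc n then (n choose (p - 1)) * (fact (p - 1) * h (Suc n - p)) else 0)"
    using p by (auto split: if_splits)
qed

section \<open>Actions of a free product\<close>

lemma free_product_class_Cons:
  assumes "group G" "group H" "c # w \<in> free_product_words G H"
  shows "free_product_rel G H `` {c # w} =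
    free_product_rel G H `` {[c]} \<otimes>\<^bsub>free_product G H\<^esub> free_product_rel G H `` {w}"
  using free_product_mult_class[OF assms(1,2), of "[c]" w] assms(3) by simp

text \<open>Injectivity holds because the classes of one-letter words generate the free product;
  surjectivity is the universal property with the symmetric group on \<open>U\<close> as
  target.\<close>

lemma bij_betw_actions_free_product:
  assumes G: "group G" and H: "group H"
  defines "i \<equiv> \<lambda>c. free_product_rel G H `` {[c]}"
  shows "bij_betw (\<lambda>\<phi>. (\<lambda>a\<in>carrier G. \<phi> (i (Inl a)), \<lambda>b\<in>carrier H. \<phi> (i (Inr b))))
    (actions (free_product G H) U) (actions G U \<times> actions H U)"
proof -
  let ?P = "free_product G H" and ?R = "free_product_rel G H" and ?W = "free_product_words G H"
  let ?r = "\<lambda>\<phi>. (\<lambda>a\<in>carrier G. \<phi> (i (Inl a)), \<lambda>b\<in>carrier H. \<phi> (i (Inr b)))"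
  interpret G: group G by fact
  interpret H: group H by fact
  interpret P: group ?P by (rule group_free_product[OF G H])
  have car: "carrier ?P = ?W // ?R" by (simp add: free_product_def)
  have one: "\<one>\<^bsub>?P\<^esub> = ?R `` {[]}" by (simp add: free_product_def)
  have i_closed: "i c \<in> carrier ?P" if "[c] \<in> ?W" for c
    unfolding i_def car using that by (rule quotientI)
  note mc = free_product_mult_class[OF G H]
  have class_cong: "?R `` {v} = ?R `` {w}" if "(v, w) \<in> ?R" for v w
    by (rule equiv_class_eq[OF equiv_free_product_rel[OF G H] that])
  have i_mult: "i (Inl (a \<otimes>\<^bsub>G\<^esub> b)) = i (Inl a) \<otimes>\<^bsub>?P\<^esub> i (Inl b)" if "a \<in> carrier G" "b \<in> carrier G" for a b
    using that mc[of "[Inl a]" "[Inl b]"] class_cong[OF free_product_rel.mult_left[of "[]" G H "[]" a b]]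
    by (simp add: i_def InlI InrI)
  have i_mult': "i (Inr (a \<otimes>\<^bsub>H\<^esub> b)) = i (Inr a) \<otimes>\<^bsub>?P\<^esub> i (Inr b)" if "a \<in> carrier H" "b \<in> carrier H" for a b
    using that mc[of "[Inr a]" "[Inr b]"] class_cong[OF free_product_rel.mult_right[of "[]" G H "[]" a b]]
    by (simp add: i_def InlI InrI)
  have il: "i (Inl a) \<in> carrier ?P" if "a \<in> carrier G" for a using that by (intro i_closed) auto
  have ir: "i (Inr b) \<in> carrier ?P" if "b \<in> carrier H" for b using that by (intro i_closed) auto
  show ?thesis
  proof (rule bij_betw_imageI)
    show "inj_on ?r (actions ?P U)"
    proof (rule inj_onI)
      fix \<phi> \<psi> assume \<phi>: "\<phi> \<in> actions ?P U" and \<psi>: "\<psi> \<in> actions ?P U" and eq: "?r \<phi> = ?r \<psi>"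
      have letter: "\<phi> (i c) = \<psi> (i c)" if "c \<in> Sum_Type.Plus (carrier G) (carrier H)" for c
      proof (cases c)
        case (Inl a)
        have "fst (?r \<phi>) a = fst (?r \<psi>) a" by (simp only: eq)
        with Inl that show ?thesis by auto
      next
        case (Inr b)
        have "snd (?r \<phi>) b = snd (?r \<psi>) b" by (simp only: eq)
        with Inr that show ?thesis by auto
      qed
      have word: "\<phi> (?R `` {w}) = \<psi> (?R `` {w})" if "w \<in> ?W" for w
        using that
      proof (induction w)
        case Nil
        show ?case using P.action_one[OF \<phi>] P.action_one[OF \<psi>] by (simp add: one)
      next
        case (Cons c w)
        then have "c # w \<in> ?W" "[c] \<in> ?W" "w \<in> ?W" by auto
        moreover from this have "?R `` {w} \<in> carrier ?P" unfolding car by (intro quotientI)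
        ultimately have "\<chi> (?R `` {c # w}) = \<chi> (i c) \<circ> \<chi> (?R `` {w})" if "\<chi> \<in> actions ?P U" for \<chi>
          using actionsD(3)[OF that i_closed[of c], of "?R `` {w}"] free_product_class_Cons[OF G H, of c w]
          by (simp add: i_def)
        with \<phi> \<psi> Cons letter[of c] show ?case by simp
      qed
      show "\<phi> = \<psi>"
      proof (rule extensionalityI[of _ "carrier ?P"])
        fix A assume "A \<in> carrier ?P"
        then obtain w where "A = ?R `` {w}" "w \<in> ?W" unfolding car by (rule quotientE)
        with word show "\<phi> A = \<psi> A" by simp
      qed (simp_all add: actionsD(1)[OF \<phi>] actionsD(1)[OF \<psi>])
    qed
    show "?r ` actions ?P U = actions G U \<times> actions H U"
    proof (intro equalityI subsetI)
      fix q assume "q \<in> ?r ` actions ?P U"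
      then obtain \<phi> where \<phi>: "\<phi> \<in> actions ?P U" "q = ?r \<phi>" by blast
      have "(\<lambda>a\<in>carrier G. \<phi> (i (Inl a))) \<in> actions G U"
        by (rule actionsI) (use actionsD(2,3)[OF \<phi>(1)] il in \<open>auto simp: i_mult\<close>)
      moreover have "(\<lambda>b\<in>carrier H. \<phi> (i (Inr b))) \<in> actions H U"
        by (rule actionsI) (use actionsD(2,3)[OF \<phi>(1)] ir in \<open>auto simp: i_mult'\<close>)
      ultimately show "q \<in> actions G U \<times> actions H U" by (simp add: \<phi>(2))
    next
      fix q assume "q \<in> actions G U \<times> actions H U"
      then obtain f g where q: "q = (f, g)" "f \<in> actions G U" "g \<in> actions H U" by blast
      define K :: "('e \<Rightarrow> 'e) monoid" where
        "K = \<lparr>carrier = {p. p permutes U}, monoid.mult = (\<circ>), one = id\<rparr>"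
      have "group K"
      proof (rule groupI)
        fix p assume "p \<in> carrier K"
        then show "\<exists>r\<in>carrier K. r \<otimes>\<^bsub>K\<^esub> p = \<one>\<^bsub>K\<^esub>"
          by (intro bexI[of _ "inv_into UNIV p"]) (simp_all add: K_def permutes_inv permutes_inv_o)
      qed (simp_all add: K_def permutes_compose comp_assoc permutes_id)
      moreover have "f \<in> hom G K" "g \<in> hom H K"
        using actionsD(2,3)[OF q(2)] actionsD(2,3)[OF q(3)] by (auto simp: hom_def K_def)
      ultimately obtain h where h: "h \<in> hom ?P K" "\<And>a. a \<in> carrier G \<Longrightarrow> h (i (Inl a)) = f a"
        "\<And>b. b \<in> carrier H \<Longrightarrow> h (i (Inr b)) = g b"
        using free_product_universal[OF G H, of K f g] unfolding i_def by blast
      define \<phi> where "\<phi> = restrict h (carrier ?P)"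
      have "\<phi> \<in> actions ?P U"
        by (rule actionsI) (use h(1) in \<open>auto simp: \<phi>_def hom_def K_def\<close>)
      moreover have "(\<lambda>a\<in>carrier G. \<phi> (i (Inl a))) = f" "(\<lambda>b\<in>carrier H. \<phi> (i (Inr b))) = g"
        using h(2,3) il ir actionsD(1)[OF q(2)] actionsD(1)[OF q(3)]
        by (auto intro!: extensionalityI[of _ "carrier G"] extensionalityI[of _ "carrier H"] simp: \<phi>_def)
      ultimately show "q \<in> ?r ` actions ?P U"
        unfolding q(1) by (intro image_eqI[of _ _ \<phi>]) simp_all
    qed
  qed
qed

lemma action_number_free_product:
  assumes "group G" "group H"
  shows "action_number (free_product G H) n = action_number G n * action_number H n"
  using bij_betw_same_card[OF bij_betw_actions_free_product[OF assms]]
  by (simp add: action_number_def card_cartesian_product)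

lemma finite_actions_free_product:
  assumes "group G" "group H" "finite (actions G U)" "finite (actions H U)"
  shows "finite (actions (free_product G H) U)"
  using bij_betw_finite[OF bij_betw_actions_free_product[OF assms(1,2), of U]] assms(3,4) by simp

section \<open>Computing with polynomials in \<open>w\<close> and \<open>\<Phi>\<close>\<close>

text \<open>
  An \<^typ>\<open>int list\<close> is a polynomial in \<open>w\<close>, constant coefficient first, and an
  \<^typ>\<open>int list list\<close> a polynomial in \<open>\<Phi>\<close> with such coefficients.
\<close>

fun padd :: "int list \<Rightarrow> int list \<Rightarrow> int list" where
  "padd [] q = q"
| "padd (a # p) [] = a # p"
| "padd (a # p) (b # q) = (a + b) # padd p q"

fun pmul :: "int list \<Rightarrow> int list \<Rightarrow> int list" where
  "pmul [] q = []"
| "pmul (a # p) q = (if a = 0 then 0 # pmul p q else padd (map ((*) a) q) (0 # pmul p q))"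

text \<open>The counter is the exponent belonging to the first entry, so \<open>ptheta 0\<close> is
  \<open>w d/dw\<close>.\<close>

fun ptheta :: "int \<Rightarrow> int list \<Rightarrow> int list" where
  "ptheta n [] = []"
| "ptheta n (a # p) = n * a # ptheta (n + 1) p"

fun badd :: "int list list \<Rightarrow> int list list \<Rightarrow> int list list" where
  "badd [] Q = Q"
| "badd (p # P) [] = p # P"
| "badd (p # P) (q # Q) = padd p q # badd P Q"

fun bmul :: "int list list \<Rightarrow> int list list \<Rightarrow> int list list" where
  "bmul [] Q = []"
| "bmul (p # P) Q = badd (map (pmul p) Q) ([] # bmul P Q)"

text \<open>\<open>bder 0 P\<close> represents \<open>y dP/dy\<close>, hence its tail represents
  \<open>dP/dy\<close>.\<close>

fun bder :: "int \<Rightarrow> int list list \<Rightarrow> int list list" where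
  "bder n [] = []"
| "bder n (p # P) = map ((*) n) p # bder (n + 1) P"

text \<open>The chain rule for \<open>w d/dw\<close>, with \<open>w + 4 w^4\<close> in place of the
  derivative of \<open>\<Phi>\<close>; the two agree modulo 16.\<close>

definition btheta :: "int list list \<Rightarrow> int list list" where
  "btheta P = badd (map (ptheta 0) P) (bmul [[0,1,0,0,4]] (tl (bder 0 P)))"

definition wmul :: "int \<Rightarrow> nat \<Rightarrow> int list list \<Rightarrow> int list list" where
  "wmul c k P = map (\<lambda>p. replicate k 0 @ map ((*) c) p) P"

text \<open>
  Division by \<open>F = \<Phi>\<^sup>4 - \<Phi> + w\<close>: the step multiplies the remainder by \<open>\<Phi>\<close> and uses
  \<open>\<Phi>\<^sup>4 = F + \<Phi> - w\<close>.
\<close>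

fun bdiv_phi :: "int list list \<Rightarrow> int list list \<times> int list \<times> int list \<times> int list \<times> int list" where
  "bdiv_phi [] = ([], [], [], [], [])"
| "bdiv_phi (p # P) = (case bdiv_phi P of (Q, r0, r1, r2, r3) \<Rightarrow>
     (r3 # Q, padd p (0 # map uminus r3), padd r0 r3, r1, r2))"

text \<open>Repeated division yields the coefficients of the expansion in powers of
  \<open>F\<close>. The required power of 2 drops by one with each factor \<open>F\<close>, and
  nothing is left to test once it is \<open>1\<close>.\<close>

fun bcheck :: "nat \<Rightarrow> int list list \<Rightarrow> bool" where
  "bcheck 0 P = True"
| "bcheck (Suc k) P = (case bdiv_phi P of (Q, r0, r1, r2, r3) \<Rightarrow>
     list_all (\<lambda>a. a mod 2 ^ Suc k = 0) (r0 @ r1 @ r2 @ r3) \<and> bcheck k Q)"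

primrec peval :: "'a::comm_ring_1 \<Rightarrow> int list \<Rightarrow> 'a" where
  "peval w [] = 0"
| "peval w (a # p) = of_int a + w * peval w p"

primrec beval :: "'a::comm_ring_1 \<Rightarrow> 'a \<Rightarrow> int list list \<Rightarrow> 'a" where
  "beval w y [] = 0"
| "beval w y (p # P) = peval w p + y * beval w y P"

section \<open>Correctness of the polynomial arithmetic\<close>

lemma peval_padd [simp]: "peval w (padd p q) = peval w p + peval w q"
  by (induction p q rule: padd.induct) (simp_all add: algebra_simps)

lemma peval_smult [simp]: "peval w (map ((*) c) p) = of_int c * peval w p"
  by (induction p) (simp_all add: algebra_simps)

lemma peval_uminus [simp]: "peval w (map uminus p) = - peval w p"
  by (induction p) (simp_all add: algebra_simps)

lemma peval_shift [simp]: "peval w (replicate k 0 @ p) = w ^ k * peval w p"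
  by (induction k) (simp_all add: algebra_simps)

lemma peval_pmul [simp]: "peval w (pmul p q) = peval w p * peval w q"
  by (induction p q rule: pmul.induct) (simp_all add: algebra_simps)

lemma beval_badd [simp]: "beval w y (badd P Q) = beval w y P + beval w y Q"
  by (induction P Q rule: badd.induct) (simp_all add: algebra_simps)

lemma beval_map_pmul [simp]: "beval w y (map (pmul p) Q) = peval w p * beval w y Q"
  by (induction Q) (simp_all add: algebra_simps)

lemma beval_bmul [simp]: "beval w y (bmul P Q) = beval w y P * beval w y Q"
  by (induction P Q rule: bmul.induct) (simp_all add: algebra_simps)

lemma beval_wmul [simp]: "beval w y (wmul c k P) = of_int c * w ^ k * beval w y P"
  by (induction P) (simp_all add: wmul_def algebra_simps)

lemma bdiv_phi_correct:
  assumes "bdiv_phi P = (Q, r0, r1, r2, r3)"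
  shows "beval w y P = beval w y Q * (y ^ 4 - y + w) +
    peval w r0 + y * peval w r1 + y ^ 2 * peval w r2 + y ^ 3 * peval w r3"
  using assms
proof (induction P arbitrary: Q r0 r1 r2 r3)
  case (Cons p P)
  obtain Q' s0 s1 s2 s3 where div: "bdiv_phi P = (Q', s0, s1, s2, s3)"
    by (cases "bdiv_phi P") auto
  then have "Q = s3 # Q'" "r0 = padd p (0 # map uminus s3)" "r1 = padd s0 s3" "r2 = s1" "r3 = s2"
    using Cons.prems by auto
  then show ?case
    unfolding beval.simps(2)[of w y p P] Cons.IH[OF div]
    by (simp add: algebra_simps power2_eq_square power3_eq_cube power4_eq_xxxx)
qed simp

lemma dvd_peval:
  assumes "list_all (\<lambda>a. a mod m = 0) p"
  shows "of_int m dvd peval w p"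
  using assms
proof (induction p)
  case (Cons a p)
  then have "of_int m dvd (of_int a :: 'a)"
    by (auto elim!: dvdE simp flip: dvd_eq_mod_eq_0)
  with Cons show ?case by simp
qed simp

text \<open>The quotient is divisible by \<open>2 ^ k\<close> by induction and the divisor is even,
  so their product has the full power; the remainder was tested directly.\<close>

lemma bcheck_correct:
  assumes "2 dvd y ^ 4 - y + w" "bcheck k P"
  shows "2 ^ k dvd beval w y P"
  using assms(2)
proof (induction k P rule: bcheck.induct)
  case (2 k P)
  obtain Q r0 r1 r2 r3 where div: "bdiv_phi P = (Q, r0, r1, r2, r3)"
    by (cases "bdiv_phi P") auto
  with 2 have "2 ^ k dvd beval w y Q" by simp
  from mult_dvd_mono[OF this assms(1)] have "2 ^ Suc k dvd beval w y Q * (y ^ 4 - y + w)"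
    by (simp only: power_Suc2)
  moreover have "2 ^ Suc k dvd c * peval w r" if "r \<in> {r0, r1, r2, r3}" for c r
  proof (rule dvd_mult)
    have "list_all (\<lambda>a. a mod 2 ^ Suc k = 0) r"
      using 2(2) div that by auto
    from dvd_peval[OF this, of w] show "2 ^ Suc k dvd peval w r"
      by (simp only: of_int_power of_int_numeral)
  qed
  from this[of r0 1] this[of r1 y] this[of r2 "y ^ 2"] this[of r3 "y ^ 3"]
  have "2 ^ Suc k dvd peval w r0" "2 ^ Suc k dvd y * peval w r1"
    "2 ^ Suc k dvd y ^ 2 * peval w r2" "2 ^ Suc k dvd y ^ 3 * peval w r3" by simp_all
  ultimately show ?case
    unfolding bdiv_phi_correct[OF div] by (intro dvd_add)
qed simp

section \<open>The derivation on series and on polynomials\<close>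

definition theta :: "'a::comm_ring_1 fps \<Rightarrow> 'a fps" where
  "theta f = fps_X * fps_deriv f"

lemma theta_nth: "fps_nth (theta f) n = of_nat n * fps_nth f n"
  by (cases n) (simp_all add: theta_def)

lemma theta_add [simp]: "theta (f + g) = theta f + theta g"
  by (simp add: theta_def algebra_simps)

lemma theta_mult: "theta (f * g) = theta f * g + f * theta g"
  by (simp add: theta_def algebra_simps)

lemma theta_of_int [simp]: "theta (of_int a) = 0"
  by (simp add: theta_def flip: fps_of_int)

lemma theta_X_power: "theta (fps_X ^ k) = of_nat k * fps_X ^ k"
  by (rule fps_ext) (simp add: theta_nth fps_X_power_nth flip: fps_of_nat)

lemma peval_ptheta:
  "peval fps_X (ptheta n p) = of_int n * peval fps_X p + theta (peval fps_X p)"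
proof (induction n p rule: ptheta.induct)
  case (2 n a p)
  have "theta fps_X = (fps_X :: 'a fps)"
    by (simp add: theta_def)
  with 2 show ?case
    by (simp add: theta_mult) (simp add: algebra_simps)
qed (simp add: theta_def)

lemma beval_bder_Suc: "beval w y (bder (n + 1) P) = beval w y (bder n P) + beval w y P"
  by (induction n P rule: bder.induct) (simp_all add: algebra_simps)

lemma beval_bder_0: "beval w y (bder 0 P) = y * beval w y (tl (bder 0 P))"
  by (cases P) simp_all

lemma theta_beval:
  "theta (beval fps_X y P) =
     beval fps_X y (map (ptheta 0) P) + beval fps_X y (tl (bder 0 P)) * theta y"
proof (induction P)
  case (Cons p P)
  then show ?case
    using beval_bder_Suc[of fps_X y 0 P] beval_bder_0[of fps_X y P]
    by (simp add: theta_mult peval_ptheta algebra_simps)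
qed (simp add: theta_def)

text \<open>By the chain rule the error is a multiple of the error made in replacing
  \<open>theta y\<close>.\<close>

lemma beval_btheta:
  assumes "m dvd theta y - (fps_X + 4 * fps_X ^ 4)"
  shows "m dvd beval fps_X y (btheta P) - theta (beval fps_X y P)"
proof -
  have "beval fps_X y (btheta P) - theta (beval fps_X y P) =
      - beval fps_X y (tl (bder 0 P)) * (theta y - (fps_X + 4 * fps_X ^ 4))"
    by (simp add: theta_beval btheta_def algebra_simps power4_eq_xxxx)
  with assms show ?thesis by simp
qed

section \<open>Congruences satisfied by Phi\<close>

lemma numeral_dvd_fps_iff:
  fixes f :: "int fps"
  shows "numeral m dvd f \<longleftrightarrow> (\<forall>n. numeral m dvd fps_nth f n)"
proof
  assume "\<forall>n. numeral m dvd fps_nth f n"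
  then have "f = numeral m * Abs_fps (\<lambda>n. fps_nth f n div numeral m)"
    by (intro fps_ext) (simp add: fps_numeral_fps_const)
  then show "numeral m dvd f" by (rule dvdI)
next
  assume "numeral m dvd f"
  then obtain g where "f = numeral m * g" ..
  then show "\<forall>n. numeral m dvd fps_nth f n"
    by (simp add: fps_numeral_fps_const)
qed

lemma fps_eq_const_plus_X_mult: "f = fps_const (fps_nth f 0) + fps_X * Abs_fps (\<lambda>n. fps_nth f (Suc n))"
  for f :: "int fps"
  by (rule fps_ext) simp

text \<open>The Frobenius map modulo 2. With \<open>f = c + X g\<close> the cross term is even,
  \<open>c * c - c\<close> is even, and what remains is the claim for \<open>g\<close> with the
  index lowered by 2.\<close>

lemma fps_square_cong_compose:
  fixes f :: "int fps"
  shows "2 dvd f ^ 2 - fps_compose f (fps_X ^ 2)"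
proof -
  \<comment> \<open>The series is quantified inside the induction, since the step passes from
    \<open>f\<close> to its shift \<open>g\<close>.\<close>
  have "\<forall>f :: int fps. even (fps_nth (f ^ 2 - fps_compose f (fps_X ^ 2)) n)" for n
  proof (induction n rule: less_induct)
    case (less n)
    show ?case
    proof
      fix f :: "int fps"
      define c where "c = fps_nth f 0"
      define g where "g = Abs_fps (\<lambda>n. fps_nth f (Suc n))"
      have f: "f = fps_const c + fps_X * g"
        unfolding c_def g_def by (rule fps_eq_const_plus_X_mult)
      define h where "h = fps_compose g (fps_X ^ 2)"
      have "fps_compose f (fps_X ^ 2) = fps_const c + fps_X ^ 2 * h"
        unfolding f h_def by (simp add: fps_compose_add_distrib fps_compose_mult_distrib)
      then have "f ^ 2 - fps_compose f (fps_X ^ 2) =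
          (fps_const c * fps_const c - fps_const c) + 2 * (fps_const c * fps_X * g) +
          (g ^ 2 - h) * fps_X ^ 2"
        unfolding f by (simp add: power2_eq_square algebra_simps)
      moreover have "even (fps_nth ((g ^ 2 - h) * fps_X ^ 2) n)"
        using less[of "n - 2"] by (auto simp: h_def fps_X_power_mult_right_nth)
      ultimately show "even (fps_nth (f ^ 2 - fps_compose f (fps_X ^ 2)) n)"
        by (auto simp: fps_numeral_fps_const)
    qed
  qed
  then show ?thesis by (simp add: numeral_dvd_fps_iff)
qed

text \<open>The power series underlying \<open>Phi2\<close>, with variable \<open>w\<close>.\<close>

definition phi :: "int fps" where
  "phi = Abs_fps (\<lambda>k. if \<exists>n. k = 4 ^ n then 1 else 0)"

lemma four_power_cases: "(\<exists>n. k = 4 ^ n) \<longleftrightarrow> k = 1 \<or> (4 dvd k \<and> (\<exists>n. k div 4 = 4 ^ n))" for k :: nat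
proof
  assume "\<exists>n. k = 4 ^ n"
  then obtain n where "k = 4 ^ n" ..
  then show "k = 1 \<or> (4 dvd k \<and> (\<exists>n. k div 4 = 4 ^ n))" by (cases n) auto
next
  assume "k = 1 \<or> (4 dvd k \<and> (\<exists>n. k div 4 = 4 ^ n))"
  then show "\<exists>n. k = 4 ^ n"
  proof
    assume "4 dvd k \<and> (\<exists>n. k div 4 = 4 ^ n)"
    then obtain n where "k = 4 * 4 ^ n" by (metis dvd_mult_div_cancel)
    then have "k = 4 ^ Suc n" by simp
    then show ?thesis ..
  qed (auto intro: exI[of _ 0])
qed

text \<open>Multiplying an exponent \<open>4 ^ n\<close> by 4 gives the next one, so only the first
  term is lost.\<close>

lemma phi_compose: "fps_compose phi (fps_X ^ 4) = phi - fps_X"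
proof (rule fps_ext)
  fix k
  show "fps_nth (fps_compose phi (fps_X ^ 4)) k = fps_nth (phi - fps_X) k"
    using four_power_cases[of k]
    by (auto simp: fps_nth_compose_X_power phi_def )
qed

text \<open>Two applications of the Frobenius congruence lead from \<open>phi ^ 4\<close> to the
  series \<open>phi\<close> in \<open>w^4\<close>, which is \<open>phi - w\<close>.\<close>

lemma phi_power_4: "2 dvd phi ^ 4 - phi + fps_X"
proof -
  define s where "s = fps_compose phi (fps_X ^ 2)"
  have "2 dvd (phi ^ 2 - s) * (phi ^ 2 + s)"
    using fps_square_cong_compose[of phi] by (simp add: s_def)
  moreover have "2 dvd s ^ 2 - fps_compose s (fps_X ^ 2)"
    by (rule fps_square_cong_compose)
  moreover have "fps_compose s (fps_X ^ 2) = phi - fps_X"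
  proof -
    have "fps_compose s (fps_X ^ 2) = fps_compose phi (fps_X ^ 4)"
      by (rule fps_ext) (auto simp: s_def fps_nth_compose_X_power)
    then show ?thesis by (simp add: phi_compose)
  qed
  ultimately have "2 dvd (phi ^ 2 - s) * (phi ^ 2 + s) + (s ^ 2 - (phi - fps_X))"
    by (metis dvd_add)
  then show ?thesis by (simp add: algebra_simps power2_eq_square power4_eq_xxxx)
qed

text \<open>The term with exponent \<open>4 ^ n\<close> acquires the factor \<open>4 ^ n\<close>, a
  multiple of 16 from \<open>n = 2\<close> on.\<close>

lemma theta_phi: "16 dvd theta phi - (fps_X + 4 * fps_X ^ 4)"
proof -
  have "16 dvd fps_nth (theta phi - (fps_X + 4 * fps_X ^ 4)) k" for k
  proof (cases "\<exists>n. k = 4 ^ n")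
    case True
    then obtain n where n: "k = 4 ^ n" ..
    then have "fps_nth phi k = 1" by (auto simp: phi_def)
    then have *: "fps_nth (theta phi - (fps_X + 4 * fps_X ^ 4)) k =
        4 ^ n - ((if k = 1 then 1 else 0) + 4 * (if k = 4 then 1 else 0))"
      by (simp add: theta_nth fps_numeral_fps_const n)
    consider "n = 0" | "n = 1" | m where "n = Suc (Suc m)" by (metis One_nat_def not0_implies_Suc)
    then show ?thesis
    proof cases
      case 3
      then have "k \<noteq> 1 \<and> k \<noteq> 4" by (simp add: n)
      with 3 show ?thesis unfolding * by simp
    qed (simp_all only: *, simp_all add: n)
  next
    case False
    then have "k \<noteq> 1 \<and> k \<noteq> 4" by (metis power_0 power_one_right)
    with False show ?thesis
      by (simp add: theta_nth phi_def fps_X_power_nth fps_numeral_fps_const)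
  qed
  then show ?thesis by (simp add: numeral_dvd_fps_iff)
qed

section \<open>Change of the coefficient ring\<close>

text \<open>Two targets matter: the rationals, where the map is injective, and the integers modulo
  16, where it is reduction.\<close>

definition fps_of_int_fps :: "int fps \<Rightarrow> 'a::comm_ring_1 fps" where
  "fps_of_int_fps f = Abs_fps (\<lambda>n. of_int (fps_nth f n))"

lemma fps_of_int_fps_nth [simp]: "fps_nth (fps_of_int_fps f) n = of_int (fps_nth f n)"
  by (simp add: fps_of_int_fps_def)

lemma fps_of_int_fps_0 [simp]: "fps_of_int_fps 0 = 0"
  by (rule fps_ext) simp

lemma fps_of_int_fps_1 [simp]: "fps_of_int_fps 1 = 1"
  by (rule fps_ext) simp

lemma fps_of_int_fps_add [simp]: "fps_of_int_fps (f + g) = fps_of_int_fps f + fps_of_int_fps g"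
  by (rule fps_ext) simp

lemma fps_of_int_fps_diff [simp]: "fps_of_int_fps (f - g) = fps_of_int_fps f - fps_of_int_fps g"
  by (rule fps_ext) simp

lemma fps_of_int_fps_mult [simp]: "fps_of_int_fps (f * g) = fps_of_int_fps f * fps_of_int_fps g"
  by (rule fps_ext) (simp add: fps_mult_nth)

lemma fps_of_int_fps_power [simp]: "fps_of_int_fps (f ^ n) = fps_of_int_fps f ^ n"
  by (induction n) simp_all

lemma fps_of_int_fps_X [simp]: "fps_of_int_fps fps_X = fps_X"
  by (rule fps_ext) simp

lemma fps_of_int_fps_numeral [simp]: "fps_of_int_fps (numeral m) = numeral m"
  by (rule fps_ext) (simp add: fps_numeral_nth)

lemma fps_of_int_fps_of_int [simp]: "fps_of_int_fps (of_int k) = of_int k"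
  by (rule fps_ext) (simp flip: fps_of_int)

lemma fps_of_int_fps_theta [simp]: "fps_of_int_fps (theta f) = theta (fps_of_int_fps f)"
  by (rule fps_ext) (simp add: theta_nth)

lemma fps_of_int_fps_eq_iff [simp]:
  "fps_of_int_fps f = (fps_of_int_fps g :: 'a :: {comm_ring_1, ring_char_0} fps) \<longleftrightarrow> f = g"
  by (auto simp: fps_eq_iff)

text \<open>Multiplication by a power of the variable is a shift, so cancellation is valid even with
  zero divisors, as modulo 16.\<close>

lemma X_power_mult_eq_iff:
  "fps_X ^ k * f = fps_X ^ k * g \<longleftrightarrow> f = (g :: 'a::comm_ring_1 fps)"
proof
  assume eq: "fps_X ^ k * f = fps_X ^ k * g"
  show "f = g"
  proof (rule fps_ext)
    fix n
    show "fps_nth f n = fps_nth g n"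
      using arg_cong[OF eq, of "\<lambda>h. fps_nth h (n + k)"] by (simp add: fps_X_power_mult_nth)
  qed
qed simp

section \<open>The differential system\<close>

definition weighted_series :: "(nat \<Rightarrow> nat) \<Rightarrow> (nat \<Rightarrow> nat) \<Rightarrow> nat \<Rightarrow> rat fps" where
  "weighted_series t f k = Abs_fps (\<lambda>n. of_nat (t (n + k) * f n) / fact n)"

text \<open>In the recurrence of \<open>t\<close> at \<open>n + k\<close> the factor
  \<open>n + k + 1\<close> splits into \<open>n\<close>, which yields \<open>theta\<close>, and the
  constant \<open>k + 1\<close>.\<close>

lemma weighted_series_theta:
  assumes "\<And>n. t (n + 2) = t (n + 1) + (n + 1) * t n"
  shows "theta (weighted_series t f k) =
    weighted_series t f (k + 2) - weighted_series t f (k + 1) - of_nat (k + 1) * weighted_series t f k"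
proof (rule fps_ext)
  fix n
  show "fps_nth (theta (weighted_series t f k)) n = fps_nth (weighted_series t f (k + 2) -
      weighted_series t f (k + 1) - of_nat (k + 1) * weighted_series t f k) n"
    using assms[of "n + k"]
    by (simp add: theta_nth weighted_series_def add.assoc flip: fps_of_nat)
      (simp add: field_simps)
qed

lemma weighted_series_shift:
  assumes t: "\<And>n. t (n + 2) = t (n + 1) + (n + 1) * t n" and "t 0 = 1" "t 1 = 1"
    and f: "\<And>n. f (n + 5) = f (n + 4) + (n + 4) * (n + 3) * (n + 2) * (n + 1) * f n"
    and f1: "\<And>n. n < 5 \<Longrightarrow> f n = 1"
  defines "M \<equiv> weighted_series t f"
  shows "fps_X ^ 5 * M 4 = M 1 - (1 + fps_X) * M 0"
    and "fps_X ^ 5 * M 5 = M 2 - (1 + fps_X) * M 1 - M 0"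
proof -
  define q :: "nat \<Rightarrow> rat" where "q n = of_nat (f n) / fact n" for n
  \<comment> \<open>The recurrence of \<open>f\<close> divided by \<open>fact (n + 4)\<close> reads
    \<open>(n + 5) q (n + 5) = q (n + 4) + q n\<close>. The factor \<open>t\<close> is an arbitrary
    rational number here, not the sequence.\<close>
  have step: "t * q n = of_nat (n + 5) * t * q (n + 5) - t * q (n + 4)" for n t
  proof -
    have "fact (n + 4) = ((of_nat n + 4) * (of_nat n + 3) * (of_nat n + 2) * (of_nat n + 1) * fact n :: rat)"
      "fact (n + 5) = ((of_nat n + 5) * fact (n + 4) :: rat)"
      by (simp_all add: eval_nat_numeral algebra_simps)
    moreover have "of_nat n + c \<noteq> (0 :: rat)" if "c > 0" for c
      using that of_nat_0_le_iff[of n, where 'a = rat] by linarith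
    ultimately show ?thesis
      by (simp add: q_def f divide_simps del: fact_Suc) (simp add: algebra_simps)
  qed
  have nth: "fps_nth (M k) n = of_nat (t (n + k)) * q n" for k n
    by (simp add: M_def weighted_series_def q_def)
  \<comment> \<open>Initial values for the coefficients of degree below 5, which the recurrence of
    \<open>f\<close> does not reach.\<close>
  have tv: "t 2 = 2" "t 3 = 4" "t 4 = 10" "t 5 = 26" "t 6 = 76"
  proof -
    show t2: "t 2 = 2" using t[of 0] assms(2,3) by (simp add: numeral_2_eq_2)
    show t3: "t 3 = 4" using t[of 1] t2 assms(3) by (simp add: numeral_3_eq_3 numeral_2_eq_2)
    show t4: "t 4 = 10" using t[of 2] t2 t3 by simp
    show t5: "t 5 = 26" using t[of 3] t3 t4 by simp
    show "t 6 = 76" using t[of 4] t4 t5 by simp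
  qed
  have tv': "t (Suc (Suc 0)) = 2" "t (Suc (Suc (Suc 0))) = 4"
    using tv by (simp_all add: eval_nat_numeral)
  have small: "n = 0 \<or> n = 1 \<or> n = 2 \<or> n = 3 \<or> n = 4" if "n < 5" for n :: nat
    using that by auto
  have large: "\<exists>m. n = m + 5" if "\<not> n < 5" for n :: nat
    using that by (intro exI[of _ "n - 5"]) simp
  show "fps_X ^ 5 * M 4 = M 1 - (1 + fps_X) * M 0"
  proof (rule fps_ext)
    fix n
    show "fps_nth (fps_X ^ 5 * M 4) n = fps_nth (M 1 - (1 + fps_X) * M 0) n"
    proof (cases "n < 5")
      case True
      then show ?thesis
        using small[OF True] assms(2,3) tv tv' f1
        by (auto simp: nth q_def distrib_right fps_X_power_mult_nth fact_numeral)
    next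
      case False
      then obtain m where m: "n = m + 5" using large by blast
      \<comment> \<open>The recurrence of \<open>t\<close> absorbs the factor \<open>m + 5\<close>
        that \<open>step\<close> produces.\<close>
      have "t (m + 6) = t (m + 5) + (m + 5) * t (m + 4)"
        using t[of "m + 4"] by (simp add: add.commute)
      with step[of "of_nat (t (m + 4))" m] show ?thesis
        by (simp add: m nth fps_X_power_mult_nth distrib_right add.commute)
    qed
  qed
  show "fps_X ^ 5 * M 5 = M 2 - (1 + fps_X) * M 1 - M 0"
  proof (rule fps_ext)
    fix n
    show "fps_nth (fps_X ^ 5 * M 5) n = fps_nth (M 2 - (1 + fps_X) * M 1 - M 0) n"
    proof (cases "n < 5")
      case True
      then show ?thesis
        using small[OF True] assms(2,3) tv tv' f1
        by (auto simp: nth q_def distrib_right fps_X_power_mult_nth fact_numeral)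
    next
      case False
      then obtain m where m: "n = m + 5" using large by blast
      have "t (m + 7) = t (m + 6) + (m + 6) * t (m + 5)" "t (m + 6) = t (m + 5) + (m + 5) * t (m + 4)"
        using t[of "m + 5"] t[of "m + 4"] by (simp_all add: add.commute)
      with step[of "of_nat (t (m + 5))" m] show ?thesis
        by (simp add: m nth fps_X_power_mult_nth distrib_right add.commute)
    qed
  qed
qed

text \<open>The product rule for \<open>m k * G\<close> takes the place of the quotient rule. The
  logarithmic derivative \<open>T\<close> of \<open>G\<close> makes the linear relation between the
  series quadratic.\<close>

lemma theta_weighted_quotient:
  assumes t: "\<And>n. t (n + 2) = t (n + 1) + (n + 1) * t n"
    and G: "fps_nth (weighted_series t f 0) 0 \<noteq> 0"
    and T: "theta (weighted_series t f 0) = T * weighted_series t f 0"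
  defines "m \<equiv> \<lambda>k. weighted_series t f k * inverse (weighted_series t f 0)"
  shows "m (k + 2) = theta (m k) + m (k + 1) + of_nat (k + 1) * m k + m k * T"
proof -
  define G where "G = weighted_series t f 0"
  have G0: "G \<noteq> 0" using G by (auto simp: G_def)
  have mG: "m k * G = weighted_series t f k" for k
    using inverse_mult_eq_1[OF G] by (simp add: m_def G_def mult.assoc)
  have "theta (m k) * G + m k * (T * G) = theta (m k * G)"
    by (simp add: theta_mult T[folded G_def])
  also have "\<dots> = (m (k + 2) - m (k + 1) - of_nat (k + 1) * m k) * G"
    by (simp only: left_diff_distrib mult.assoc mG weighted_series_theta[of t f k, OF t])
  finally have "(m (k + 2)) * G = (theta (m k) + m (k + 1) + of_nat (k + 1) * m k + m k * T) * G"
    by (simp add: algebra_simps)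
  with G0 show ?thesis by simp
qed

section \<open>Integrality of the quotients\<close>

definition integral_upto :: "nat \<Rightarrow> rat fps \<Rightarrow> bool" where
  "integral_upto n f \<longleftrightarrow> (\<forall>i<n. fps_nth f i \<in> \<int>)"

lemma integral_upto_add: "integral_upto n f \<Longrightarrow> integral_upto n g \<Longrightarrow> integral_upto n (f + g)"
  by (simp add: integral_upto_def)

lemma integral_upto_mult: "integral_upto n f \<Longrightarrow> integral_upto n g \<Longrightarrow> integral_upto n (f * g)"
  by (auto simp: integral_upto_def fps_mult_nth intro!: Ints_sum Ints_mult)

lemma integral_upto_theta: "integral_upto n f \<Longrightarrow> integral_upto n (theta f)"
  by (auto simp: integral_upto_def theta_nth)

lemma integral_upto_X_power: "integral_upto n f \<Longrightarrow> integral_upto (n + k) (fps_X ^ k * f)"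
  by (auto simp: integral_upto_def fps_X_power_mult_nth)

lemma integral_upto_of_int_fps: "integral_upto n (fps_of_int_fps f)"
  by (simp add: integral_upto_def)

lemma integral_upto_mono: "integral_upto n f \<Longrightarrow> m \<le> n \<Longrightarrow> integral_upto m f"
  by (simp add: integral_upto_def)

lemma integral_imp_fps_of_int_fps:
  assumes "\<And>n. integral_upto n f"
  obtains g where "f = fps_of_int_fps g"
proof
  have "fps_nth f i \<in> \<int>" for i
    using assms[of "Suc i"] by (simp add: integral_upto_def)
  then show "f = fps_of_int_fps (Abs_fps (\<lambda>i. \<lfloor>fps_nth f i\<rfloor>))"
    by (intro fps_ext) simp
qed

text \<open>If \<open>m 1\<close> and \<open>m 2\<close> are integral below degree \<open>n\<close>,
  the recurrence makes \<open>m 4\<close> and \<open>m 5\<close> so, and the factor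
  \<open>fps_X ^ 5\<close> gives back integrality of \<open>m 1\<close> and \<open>m 2\<close> below
  degree \<open>n + 5\<close>.\<close>

lemma riccati_integral:
  fixes m :: "nat \<Rightarrow> rat fps"
  assumes T: "T = fps_of_int_fps T'"
    and rec: "\<And>k. k \<ge> 1 \<Longrightarrow> m (k + 2) = theta (m k) + m (k + 1) + of_nat (k + 1) * m k + m k * T"
    and m1: "m 1 = 1 + fps_X + fps_X ^ 5 * m 4"
    and m2: "m 2 = 1 + (1 + fps_X) * m 1 + fps_X ^ 5 * m 5"
  obtains a where "\<And>k. k \<ge> 1 \<Longrightarrow> m k = fps_of_int_fps (a k)"
proof -
  note iu = integral_upto_add integral_upto_mult integral_upto_theta integral_upto_X_power
  have iu_consts: "integral_upto n 1" "integral_upto n fps_X" "integral_upto n (of_nat k)"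
      "integral_upto n T" for n k
    using integral_upto_of_int_fps[of n 1] integral_upto_of_int_fps[of n fps_X]
      integral_upto_of_int_fps[of n "of_nat k"] integral_upto_of_int_fps[of n T']
      fps_of_int_fps_of_int[of "int k", where 'a = rat]
    by (simp_all add: T)
  have up: "integral_upto n (m k) \<and> integral_upto n (m (k + 1))"
    if "integral_upto n (m 1)" "integral_upto n (m 2)" "k \<ge> 1" for n k
    using that(3)
  proof (induction k rule: dec_induct)
    case base
    then show ?case using that by (simp add: numeral_2_eq_2)
  next
    case (step k)
    then have "integral_upto n (m (k + 2))"
      unfolding rec[OF step(1)] by (intro iu iu_consts) auto
    with step show ?case by simp
  qed
  have base: "integral_upto n (m 1) \<and> integral_upto n (m 2)" for n
  proof (induction n)
    case (Suc n)
    have 1: "integral_upto (n + 5) (m 1)"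
      unfolding m1 using up[of n 4] Suc by (intro iu iu_consts) auto
    then have "integral_upto (n + 5) (m 2)"
      unfolding m2 using up[of n 5] Suc by (intro iu iu_consts) auto
    with 1 show ?case using integral_upto_mono[of "n + 5" _ "Suc n"] by simp
  qed (simp add: integral_upto_def)
  have "\<exists>g. m k = fps_of_int_fps g" if "k \<ge> 1" for k
    using up[of _ k] base that by (metis integral_imp_fps_of_int_fps)
  with that show thesis by metis
qed

text \<open>The series have factorials in their denominators; integrality of their quotients is what
  permits reduction modulo 16 later.\<close>

lemma riccati_system_int:
  assumes t: "\<And>n. t (n + 2) = t (n + 1) + (n + 1) * t n" and t01: "t 0 = 1" "t 1 = 1"
    and f: "\<And>n. f (n + 5) = f (n + 4) + (n + 4) * (n + 3) * (n + 2) * (n + 1) * f n"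
    and f1: "\<And>n. n < 5 \<Longrightarrow> f n = 1"
    and T: "theta (weighted_series t f 0) = fps_of_int_fps T * weighted_series t f 0"
  obtains a :: "nat \<Rightarrow> int fps" where "a 2 = a 1 + 1 + T"
    "a 3 = theta (a 1) + a 2 + 2 * a 1 + a 1 * T"
    "a 4 = theta (a 2) + a 3 + 3 * a 2 + a 2 * T"
    "a 5 = theta (a 3) + a 4 + 4 * a 3 + a 3 * T"
    "a 1 = 1 + fps_X + fps_X ^ 5 * a 4"
    "a 2 = 1 + (1 + fps_X) * a 1 + fps_X ^ 5 * a 5"
proof -
  define M where "M = weighted_series t f"
  define m where "m = (\<lambda>k. M k * inverse (M 0))"
  have M0: "fps_nth (M 0) 0 \<noteq> 0"
    by (simp add: M_def weighted_series_def t01 f1)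
  have inv: "M 0 * inverse (M 0) = 1"
    using inverse_mult_eq_1'[OF M0] .
  have rec: "m (k + 2) = theta (m k) + m (k + 1) + of_nat (k + 1) * m k + m k * fps_of_int_fps T" for k
    using theta_weighted_quotient[OF t M0[unfolded M_def] T] by (simp add: m_def M_def)
  note shift = weighted_series_shift[OF t t01 f f1, folded M_def]
  have m0: "m 0 = 1" by (simp add: m_def inv)
  have m1: "m 1 = 1 + fps_X + fps_X ^ 5 * m 4"
    using arg_cong[OF shift(1), of "\<lambda>x. x * inverse (M 0)"] inv
    by (simp add: m_def algebra_simps)
  have m2: "m 2 = 1 + (1 + fps_X) * m 1 + fps_X ^ 5 * m 5"
    using arg_cong[OF shift(2), of "\<lambda>x. x * inverse (M 0)"] inv
    by (simp add: m_def algebra_simps)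
  obtain a where a: "\<And>k. k \<ge> 1 \<Longrightarrow> m k = fps_of_int_fps (a k)"
    by (rule riccati_integral[OF HOL.refl rec m1 m2]) auto
  have emb: "fps_of_int_fps f = (fps_of_int_fps g :: rat fps) \<Longrightarrow> f = g" for f g by simp
  \<comment> \<open>The case \<open>k = 0\<close>: since \<open>m 0 = 1\<close>, the recurrence is
    linear and determines \<open>T\<close>.\<close>
  have "m 2 = m 1 + 1 + fps_of_int_fps T"
    using rec[of 0] theta_of_int[of 1, where 'a = rat] by (simp add: m0 numeral_2_eq_2)
  then have e2: "a 2 = a 1 + 1 + T" by (intro emb) (simp add: a)
  have "a 3 = theta (a 1) + a 2 + 2 * a 1 + a 1 * T"
    "a 4 = theta (a 2) + a 3 + 3 * a 2 + a 2 * T"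
    "a 5 = theta (a 3) + a 4 + 4 * a 3 + a 3 * T"
    using rec[of 1] rec[of 2] rec[of 3] by (auto intro!: emb simp: a numeral_2_eq_2[symmetric] numeral_3_eq_3[symmetric])
  moreover have "a 1 = 1 + fps_X + fps_X ^ 5 * a 4" "a 2 = 1 + (1 + fps_X) * a 1 + fps_X ^ 5 * a 5"
    using m1 m2 by (auto intro!: emb simp: a)
  ultimately show thesis using that e2 by blast
qed

section \<open>The solution modulo 16\<close>

definition agree_upto :: "nat \<Rightarrow> 'a::comm_ring_1 fps \<Rightarrow> 'a fps \<Rightarrow> bool" where
  "agree_upto n f g \<longleftrightarrow> (\<forall>i<n. fps_nth f i = fps_nth g i)"

lemma agree_upto_refl: "agree_upto n f f"
  by (simp add: agree_upto_def)

lemma agree_upto_add: "agree_upto n f f' \<Longrightarrow> agree_upto n g g' \<Longrightarrow> agree_upto n (f + g) (f' + g')"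
  by (simp add: agree_upto_def)

lemma agree_upto_diff: "agree_upto n f f' \<Longrightarrow> agree_upto n g g' \<Longrightarrow> agree_upto n (f - g) (f' - g')"
  by (simp add: agree_upto_def)

lemma agree_upto_mult: "agree_upto n f f' \<Longrightarrow> agree_upto n g g' \<Longrightarrow> agree_upto n (f * g) (f' * g')"
  by (auto simp: agree_upto_def fps_mult_nth intro!: sum.cong)

lemma agree_upto_theta: "agree_upto n f f' \<Longrightarrow> agree_upto n (theta f) (theta f')"
  by (simp add: agree_upto_def theta_nth)

lemma agree_upto_X_power:
  "agree_upto n f f' \<Longrightarrow> agree_upto (n + k) (fps_X ^ k * f) (fps_X ^ k * f')"
  by (auto simp: agree_upto_def fps_X_power_mult_nth)

text \<open>
  The system of \<open>riccati_system_int\<close> after the substitution \<open>z = w\<^sup>3\<close>, where modulo 16 the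
  derivation \<open>z d/dz\<close> becomes \<open>11 w d/dw\<close> because \<open>3 * 11 = 33\<close>.
\<close>

definition riccati_system :: "(nat \<Rightarrow> 'a::comm_ring_1 fps) \<Rightarrow> 'a fps \<Rightarrow> bool" where
  "riccati_system a T \<longleftrightarrow>
     a 2 = a 1 + 1 + T \<and>
     a 3 = 11 * theta (a 1) + a 2 + 2 * a 1 + a 1 * T \<and>
     a 4 = 11 * theta (a 2) + a 3 + 3 * a 2 + a 2 * T \<and>
     a 5 = 11 * theta (a 3) + a 4 + 4 * a 3 + a 3 * T \<and>
     a 1 = 1 + fps_X ^ 3 + fps_X ^ 15 * a 4 \<and>
     a 2 = 1 + (1 + fps_X ^ 3) * a 1 + fps_X ^ 15 * a 5"

text \<open>Agreement of \<open>a 1\<close> and \<open>a 2\<close> below degree \<open>n\<close>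
  passes to \<open>T\<close>, then to \<open>a 4\<close> and \<open>a 5\<close>, and comes back
  through \<open>fps_X ^ 15\<close> below degree \<open>n + 15\<close>. No division occurs, so the
  ring may have zero divisors.\<close>

lemma riccati_system_unique:
  assumes "riccati_system a T" "riccati_system b U"
  shows "T = U"
proof -
  note ag = agree_upto_add agree_upto_mult agree_upto_theta agree_upto_diff agree_upto_refl
  note a = assms(1)[unfolded riccati_system_def] and b = assms(2)[unfolded riccati_system_def]
  have aT: "T = a 2 - a 1 - 1" and bU: "U = b 2 - b 1 - 1"
    using a[THEN conjunct1] b[THEN conjunct1] by simp_all
  have a3: "a 3 = 11 * theta (a 1) + a 2 + 2 * a 1 + a 1 * T"
    and a4: "a 4 = 11 * theta (a 2) + a 3 + 3 * a 2 + a 2 * T"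
    and a5: "a 5 = 11 * theta (a 3) + a 4 + 4 * a 3 + a 3 * T"
    and a1: "a 1 = 1 + fps_X ^ 3 + fps_X ^ 15 * a 4"
    and a2: "a 2 = 1 + (1 + fps_X ^ 3) * a 1 + fps_X ^ 15 * a 5"
    using a by blast+
  have b3: "b 3 = 11 * theta (b 1) + b 2 + 2 * b 1 + b 1 * U"
    and b4: "b 4 = 11 * theta (b 2) + b 3 + 3 * b 2 + b 2 * U"
    and b5: "b 5 = 11 * theta (b 3) + b 4 + 4 * b 3 + b 3 * U"
    and b1: "b 1 = 1 + fps_X ^ 3 + fps_X ^ 15 * b 4"
    and b2: "b 2 = 1 + (1 + fps_X ^ 3) * b 1 + fps_X ^ 15 * b 5"
    using b by blast+
  have "agree_upto n (a 1) (b 1) \<and> agree_upto n (a 2) (b 2)" for n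
  proof (induction n)
    case (Suc n)
    have T: "agree_upto n T U"
      unfolding aT bU using Suc by (intro ag) auto
    have 3: "agree_upto n (a 3) (b 3)"
      unfolding a3 b3 using Suc T by (intro ag) auto
    have 4: "agree_upto n (a 4) (b 4)"
      unfolding a4 b4 using Suc T 3 by (intro ag) auto
    have 5: "agree_upto n (a 5) (b 5)"
      unfolding a5 b5 using Suc T 3 4 by (intro ag) auto
    have 1: "agree_upto (n + 15) (a 1) (b 1)"
      unfolding a1 b1 using 4 by (intro ag agree_upto_X_power)
    have "agree_upto (n + 15) (a 2) (b 2)"
      unfolding a2 b2 using 1 5 by (intro ag(1,2) agree_upto_X_power agree_upto_refl)
    with 1 show ?case by (simp add: agree_upto_def)
  qed (simp add: agree_upto_def)
  then have "a 1 = b 1" "a 2 = b 2"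
    by (auto simp: agree_upto_def fps_eq_iff)
  then show ?thesis by (simp add: aT bU)
qed

section \<open>Reduction modulo 16\<close>

lemma of_int_mod_16_eq_0_iff: "(of_int k :: 16) = 0 \<longleftrightarrow> 16 dvd k"
  using of_int_eq_0_iff_char_dvd[of k, where 'a = 16] by simp

lemma fps_of_int_fps_mod_16_eq_0_iff: "fps_of_int_fps f = (0 :: 16 fps) \<longleftrightarrow> 16 dvd f"
  by (simp add: numeral_dvd_fps_iff fps_eq_iff of_int_mod_16_eq_0_iff)

lemma fps_of_int_fps_mod_16_eq_iff: "fps_of_int_fps f = (fps_of_int_fps g :: 16 fps) \<longleftrightarrow> 16 dvd f - g"
  using fps_of_int_fps_mod_16_eq_0_iff[of "f - g"] by simp

lemma fps_mod_16: "(16 :: 16 fps) = 0"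
  using fps_of_int_fps_mod_16_eq_0_iff[of 16] by simp

lemma fps_of_int_fps_peval [simp]: "fps_of_int_fps (peval w p) = peval (fps_of_int_fps w) p"
  by (induction p) simp_all

lemma fps_of_int_fps_beval [simp]:
  "fps_of_int_fps (beval w y P) = beval (fps_of_int_fps w) (fps_of_int_fps y) P"
  by (induction P) simp_all

lemma theta_X_power_mult: "theta (fps_X ^ k * f) = fps_X ^ k * (theta f + of_nat k * f)"
  by (simp add: theta_mult theta_X_power algebra_simps)
text \<open>
  The three lists represent \<open>w\<^sup>5 m\<^sub>1\<close>, \<open>w\<^sup>1\<^sup>0 T\<close> and \<open>w\<^sup>1\<^sup>5 m\<^sub>3\<close>. The second is read off the claim; the others
  were found by solving linear systems over the field with two elements for the binary digits of the
  coefficients, matching the power series solution.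
\<close>

definition cand_m1 :: "int list list" where
  "cand_m1 =
  [[0,0,0,0,0,9,0,0,2,0,0,4,0,0,4,0,0,8,0,0,10,0,0,0,0,0,0,0,0,8,0,0,8,0,0,8,0,0,0,0,0,8,0,0,8],
   [0,0,0,0,0,0,0,8,0,0,0,0,0,0,0,0,8,0,0,0,0,0,8,0,0,8,0,0,0,0,0,0,0,0,0,0,0,0,0,0,8],
   [0,0,0,0,0,0,4,0,0,12,0,0,8,0,0,8,0,0,8,0,0,8,0,0,8,0,0,0,0,0,8],
   [0,0,0,0,0,8,0,0,8,0,0,0,0,0,0,0,0,0,0,0,8],
   [0,8,0,0,6,0,0,4,0,0,4],
   [],
   [0,0,4,0,0,4],
   [],
   [1]]"

definition cand_T :: "int list list" where
  "cand_T =
  [[0,0,0,0,7,0,0,0,0,0,0,0,0,14,0,0,4,0,0,8,0,0,0,0,0,2,0,0,8,0,0,0,0,0,8,0,0,0,0,0,4,0,0,0,0,0,0,0,0,8],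
   [0,0,0,12,0,0,0,0,0,8,0,0,8,0,0,0,0,0,8,0,0,0,0,0,0,0,0,0,0,0,0,0,0,8],
   [0,0,10,0,0,0,0,0,8,0,0,12,0,0,0,0,0,8,0,0,0,0,0,0,0,0,0,0,0,0,0,0,8],
   [0,12,0,0,0,0,0,0,0,0,8,0,0,0,0,0,8,0,0,0,0,0,0,0,0,0,0,0,0,0,0,8],
   [7,0,0,12,0,0,8,0,0,6,0,0,0,0,0,0,0,0,8,0,0,8,0,0,8,0,0,0,0,0,0,0,0,8,0,0,0,0,0,0,0,0,0,0,0,8],
   [0,0,4,0,0,8,0,0,8,0,0,8],
   [0,4,0,0,0,0,0,12,0,0,8,0,0,0,0,0,8,0,0,0,0,0,0,0,0,0,0,0,0,0,0,8],
   [12,0,0,0,0,0,8,0,0,8],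
   [0,0,2,0,0,5,0,0,8,0,0,4,0,0,0,0,0,8,0,0,12,0,0,8,0,0,0,0,0,8,0,0,8,0,0,8],
   [0,4,0,0,0,0,0,8,0,0,8,0,0,0,0,0,8,0,0,0,0,0,0,0,0,0,0,0,0,0,0,8],
   [2,0,0,0,0,0,0,0,0,12],
   [0,0,0,0,0,8],
   [0,12,0,0,12,0,0,12,0,0,8,0,0,8,0,0,8,0,0,0,0,0,0,0,0,8,0,0,0,0,0,8],
   [12,0,0,0,0,0,8,0,0,8],
   [0,0,8,0,0,4]]"

definition cand_m3 :: "int list list" where
  "cand_m3 =
  [[0,0,0,2,0,0,2,0,0,5,0,0,14,0,0,8,0,0,0,0,0,4,0,0,14,0,0,12,0,0,12,0,0,0,0,0,8,0,0,8,0,0,12,0,0,12,0,0,0,0,0,0,0,0,0,0,0,0,0,0,8],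
   [0,0,14,0,0,0,0,0,0,0,0,8,0,0,0,0,0,0,0,0,8,0,0,0,0,0,0,0,0,8,0,0,8,0,0,8,0,0,0,0,0,8,0,0,8],
   [0,6,0,0,10,0,0,6,0,0,4,0,0,4,0,0,12,0,0,0,0,0,12,0,0,4,0,0,0,0,0,8,0,0,8,0,0,0,0,0,12],
   [10,0,0,0,0,0,0,0,0,8,0,0,0,0,0,8,0,0,8,0,0,8,0,0,8,0,0,0,0,0,8],
   [0,0,8,0,0,5,0,0,4,0,0,4,0,0,4,0,0,0,0,0,6],
   [0,12],
   [8,0,0,8,0,0,4,0,0,4],
   [],
   [0,6,0,0,1,0,0,2,0,0,2],
   [14],
   [0,0,2,0,0,2],
   [],
   [1]]"

section \<open>Verification of the candidate solution\<close>

text \<open>The system multiplied by powers of \<open>w\<close>, with \<open>P2\<close> and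
  \<open>P3\<close> standing for \<open>w^10 m_2\<close> and \<open>w^15 m_3\<close>. Applying
  \<open>theta\<close> to \<open>w^k f\<close> brings in \<open>k f\<close>, whence the constants
  \<open>-52 = 3 - 55\<close>, \<open>-107 = 3 - 110\<close> and \<open>-161 = 4 - 165\<close>. In
  \<open>c3\<close> only \<open>A 5 - A 4\<close> occurs, which \<open>A 3\<close> and
  \<open>T\<close> express.\<close>

lemma candidate_algebra:
  fixes A :: "nat \<Rightarrow> 'a::comm_ring_1 fps"
  assumes P: "P1 = fps_X ^ 5 * A 1" "PT = fps_X ^ 10 * T" "P2 = fps_X ^ 5 * P1 + (fps_X ^ 10 + PT)"
    and A: "A 2 = A 1 + 1 + T" "A 3 = 11 * theta (A 1) + A 2 + 2 * A 1 + A 1 * T"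
      "A 4 = 11 * theta (A 2) + A 3 + 3 * A 2 + A 2 * T"
      "A 5 = 11 * theta (A 3) + A 4 + 4 * A 3 + A 3 * T"
    and c1: "11 * fps_X ^ 10 * theta P1 - 52 * fps_X ^ 10 * P1 + fps_X ^ 15 + fps_X ^ 5 * PT + P1 * PT = P3"
    and c2: "fps_X ^ 15 * P1 = fps_X ^ 20 + fps_X ^ 23 + fps_X ^ 15 *
      (11 * fps_X ^ 10 * theta P2 - 107 * fps_X ^ 10 * P2 + fps_X ^ 5 * P3 + P2 * PT)"
    and c3: "fps_X ^ 15 * P2 = 2 * fps_X ^ 20 * P1 + fps_X ^ 23 * P1 - fps_X ^ 28 + fps_X ^ 15 *
      (11 * fps_X ^ 10 * theta P3 - 161 * fps_X ^ 10 * P3 + P3 * PT)"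
  shows "riccati_system A T"
proof -
  let ?X = "fps_X :: 'a fps"
  define x where "x = ?X ^ 5"
  have x: "?X ^ 5 = x" "?X ^ 10 = x * x" "?X ^ 15 = x * (x * x)" "?X ^ 20 = x * (x * (x * x))"
    "?X ^ 23 = x * (x * (x * (x * ?X ^ 3)))" "?X ^ 25 = x * (x * (x * (x * x)))"
    "?X ^ 28 = x * (x * (x * (x * (x * ?X ^ 3))))"
    by (simp_all add: x_def flip: power_add)
  have P2: "P2 = x * (x * A 2)"
    unfolding P x A(1) by (simp add: algebra_simps)
  have th: "theta (x * f) = x * (theta f + 5 * f)" for f
    unfolding x_def theta_X_power_mult by simp
  have P3: "P3 = x * (x * (x * A 3))"
    unfolding c1[symmetric] P(1,2) A(2) A(1) x th by (simp add: algebra_simps)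
  note PP = P(1,2) P2 P3 x
  have "?X ^ 20 * A 1 - ?X ^ 20 * (1 + ?X ^ 3 + ?X ^ 15 * A 4) =
      ?X ^ 15 * P1 - (?X ^ 20 + ?X ^ 23 + ?X ^ 15 *
        (11 * ?X ^ 10 * theta P2 - 107 * ?X ^ 10 * P2 + ?X ^ 5 * P3 + P2 * PT))"
    unfolding PP A(3) th by (simp add: algebra_simps)
  then have "?X ^ 20 * A 1 = ?X ^ 20 * (1 + ?X ^ 3 + ?X ^ 15 * A 4)"
    unfolding c2[symmetric] by (simp only: diff_self right_minus_eq)
  then have A1: "A 1 = 1 + ?X ^ 3 + ?X ^ 15 * A 4"
    by (simp only: X_power_mult_eq_iff)
  \<comment> \<open>The equation for \<open>A 2\<close> minus the one for \<open>A 1\<close>; the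
    latter is added back at the end.\<close>
  have "?X ^ 25 * A 2 - ?X ^ 25 * (2 * A 1 + ?X ^ 3 * A 1 - ?X ^ 3 + ?X ^ 15 * (A 5 - A 4)) =
      ?X ^ 15 * P2 - (2 * ?X ^ 20 * P1 + ?X ^ 23 * P1 - ?X ^ 28 + ?X ^ 15 *
        (11 * ?X ^ 10 * theta P3 - 161 * ?X ^ 10 * P3 + P3 * PT))"
    unfolding PP A(4) th by (simp add: algebra_simps)
  then have "?X ^ 25 * A 2 = ?X ^ 25 * (2 * A 1 + ?X ^ 3 * A 1 - ?X ^ 3 + ?X ^ 15 * (A 5 - A 4))"
    unfolding c3[symmetric] by (simp only: diff_self right_minus_eq)
  then have "A 2 = 2 * A 1 + ?X ^ 3 * A 1 - ?X ^ 3 + ?X ^ 15 * (A 5 - A 4)"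
    by (simp only: X_power_mult_eq_iff)
  also have "\<dots> = 1 + (1 + ?X ^ 3) * A 1 + ?X ^ 15 * A 5 + (A 1 - (1 + ?X ^ 3 + ?X ^ 15 * A 4))"
    by (simp add: algebra_simps)
  also have "A 1 - (1 + ?X ^ 3 + ?X ^ 15 * A 4) = 0"
    by (rule right_minus_eq[THEN iffD2]) (rule A1)
  finally have "A 2 = 1 + (1 + ?X ^ 3) * A 1 + ?X ^ 15 * A 5" by simp
  with A A1 show ?thesis unfolding riccati_system_def by blast
qed

text \<open>Represents \<open>w^10 m_2\<close>, by \<open>m_2 = m_1 + 1 + T\<close>.\<close>

definition cand_m2 :: "int list list" where
  "cand_m2 = badd (wmul 1 5 cand_m1) (badd (wmul 1 10 [[1]]) cand_T)"

text \<open>This and the next two checks are the hypotheses \<open>c1\<close>, \<open>c2\<close> and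
  \<open>c3\<close> of \<open>candidate_algebra\<close>, brought to one side and tested modulo
  \<open>2 ^ 4\<close>.\<close>

lemma cand_check_1:
  "bcheck 4 (badd (wmul 11 10 (btheta cand_m1)) (badd (wmul (- 52) 10 cand_m1) (badd (wmul 1 15 [[1]])
     (badd (wmul 1 5 cand_T) (badd (bmul cand_m1 cand_T) (wmul (- 1) 0 cand_m3))))))"
  by code_simp

lemma cand_check_2:
  "bcheck 4 (badd (wmul (- 1) 15 cand_m1) (badd (wmul 1 20 [[1]]) (badd (wmul 1 23 [[1]])
     (wmul 1 15 (badd (wmul 11 10 (btheta cand_m2)) (badd (wmul (- 107) 10 cand_m2)
       (badd (wmul 1 5 cand_m3) (bmul cand_m2 cand_T))))))))"
  by code_simp

lemma cand_check_3:
  "bcheck 4 (badd (wmul (- 1) 15 cand_m2) (badd (wmul 2 20 cand_m1) (badd (wmul 1 23 cand_m1)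
     (badd (wmul (- 1) 28 [[1]]) (wmul 1 15 (badd (wmul 11 10 (btheta cand_m3))
       (badd (wmul (- 161) 10 cand_m3) (bmul cand_m3 cand_T))))))))"
  by code_simp

text \<open>
  The candidates are Laurent polynomials in \<open>w\<close> with poles. That these cancel modulo 16 is checked on
  the truncation \<open>w + w\<^sup>4\<close> of \<open>\<Phi>\<close>.
\<close>

primrec bsubst :: "int list \<Rightarrow> int list list \<Rightarrow> int list" where
  "bsubst q [] = []"
| "bsubst q (p # P) = padd p (pmul q (bsubst q P))"

lemma peval_bsubst: "peval w (bsubst q P) = beval w (peval w q) P"
  by (induction P) simp_all

lemma beval_cong_dvd: "d dvd y - y' \<Longrightarrow> d dvd beval w y P - beval w y' P"
proof (induction P)
  case (Cons p P)
  have "beval w y (p # P) - beval w y' (p # P) =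
      y * (beval w y P - beval w y' P) + (y - y') * beval w y' P"
    by (simp add: algebra_simps)
  with Cons show ?case by simp
qed simp

lemma peval_split: "peval w p = peval w (take n p) + w ^ n * peval w (drop n p)"
proof (induction n arbitrary: p)
  case (Suc n)
  show ?case
  proof (cases p)
    case (Cons a q)
    then show ?thesis
      using Suc.IH[of q] by (simp add: distrib_left mult.assoc)
  qed simp
qed simp

text \<open>The exponent of \<open>phi\<close> after 1 and 4 is 16, so replacing \<open>phi\<close>
  by \<open>w + w^4\<close> changes no coefficient below degree 16; \<open>N \<le> 16\<close> keeps
  the test within this range.\<close>

lemma cand_no_pole:
  assumes "list_all (\<lambda>a. a mod 16 = 0) (take N (bsubst [0, 1, 0, 0, 1] P))" "N \<le> 16"
  obtains A :: "16 fps" where "beval fps_X (fps_of_int_fps phi) P = fps_X ^ N * A"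
proof -
  let ?q = "[0, 1, 0, 0, 1]"
  define r where "r = fps_shift 16 phi"
  have "phi - peval fps_X ?q = fps_X ^ 16 * r"
  proof (rule fps_ext)
    fix n :: nat
    have "\<not> (\<exists>k. n = 4 ^ k)" if "n < 16" "n \<noteq> 1" "n \<noteq> 4"
    proof
      assume "\<exists>k. n = 4 ^ k"
      then obtain k where k: "n = 4 ^ k" ..
      with that(1) have "(4::nat) ^ k < 4 ^ 2" by simp
      then have "k < 2" by (simp only: power_strict_increasing_iff)
      with k that show False by (auto simp: less_2_cases_iff)
    qed
    moreover have "\<exists>k. (1::nat) = 4 ^ k" "\<exists>k. (4::nat) = 4 ^ k"
      by (auto intro: exI[of _ 0] exI[of _ 1])
    ultimately have phi: "fps_nth phi n = (if n = 1 \<or> n = 4 then 1 else 0)" if "n < 16"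
      using that by (auto simp: phi_def simp del: One_nat_def)
    have "peval fps_X ?q = fps_X + (fps_X ^ 4 :: int fps)"
      by (simp add: algebra_simps power4_eq_xxxx)
    then have *: "fps_nth (phi - peval fps_X ?q) n =
        fps_nth phi n - ((if n = 1 then 1 else 0) + (if n = 4 then 1 else 0))"
      by (simp only: fps_sub_nth fps_add_nth fps_X_nth fps_X_power_nth)
    show "fps_nth (phi - peval fps_X ?q) n = fps_nth (fps_X ^ 16 * r) n"
      unfolding * by (cases "n < 16") (simp_all add: phi r_def fps_X_power_mult_nth)
  qed
  then have "fps_X ^ 16 dvd phi - peval fps_X ?q" by simp
  then have "fps_X ^ 16 dvd beval fps_X phi P - peval fps_X (bsubst ?q P)"
    unfolding peval_bsubst by (rule beval_cong_dvd)
  then have "fps_X ^ N dvd beval fps_X phi P - peval fps_X (bsubst ?q P)"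
    using assms(2) by (meson dvd_trans le_imp_power_dvd)
  then obtain u where u: "beval fps_X phi P - peval fps_X (bsubst ?q P) = fps_X ^ N * u" ..
  obtain v where v: "peval fps_X (take N (bsubst ?q P)) = of_int 16 * (v :: int fps)"
    using dvd_peval[OF assms(1), of "fps_X :: int fps"] by blast
  have "beval fps_X phi P = fps_X ^ N * (u + peval fps_X (drop N (bsubst ?q P))) + 16 * v"
    using u v peval_split[of "fps_X :: int fps" "bsubst ?q P" N] by (simp add: algebra_simps)
  from arg_cong[OF this, of "fps_of_int_fps :: _ \<Rightarrow> 16 fps"]
  have "beval fps_X (fps_of_int_fps phi) P =
      fps_X ^ N * (fps_of_int_fps (u + peval fps_X (drop N (bsubst ?q P))) :: 16 fps)"
    by (simp only: fps_of_int_fps_add fps_of_int_fps_mult fps_of_int_fps_beval fps_of_int_fps_X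
        fps_of_int_fps_power fps_of_int_fps_numeral fps_mod_16 mult_zero_left add_0_right)
  then show thesis by (rule that)
qed

text \<open>Cancellation of the poles supplies \<open>A1\<close> and \<open>T\<close>; the other
  entries are defined by the recurrences, and the two remaining equations follow from the three
  checks.\<close>

lemma cand_riccati:
  obtains A :: "nat \<Rightarrow> 16 fps" and T where "riccati_system A T"
    "beval fps_X (fps_of_int_fps phi) cand_T = fps_X ^ 10 * T"
proof -
  define y :: "16 fps" where "y = fps_of_int_fps phi"
  \<comment> \<open>Divisibility by 16, obtained over the integers, becomes vanishing in the ring of
    integers modulo 16.\<close>
  have check: "beval fps_X y P = 0" if "bcheck 4 P" for P
    using bcheck_correct[OF phi_power_4 that]
    by (simp add: y_def flip: fps_of_int_fps_mod_16_eq_0_iff)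
  have theta: "beval fps_X y (btheta P) = theta (beval fps_X y P)" for P
    using beval_btheta[OF theta_phi, of P]
    by (simp add: y_def flip: fps_of_int_fps_mod_16_eq_0_iff)
  have "list_all (\<lambda>a. a mod 16 = 0) (take 5 (bsubst [0, 1, 0, 0, 1] cand_m1))"
    by code_simp
  then obtain A1 where A1: "beval fps_X y cand_m1 = fps_X ^ 5 * A1"
    unfolding y_def by (rule cand_no_pole) simp
  have "list_all (\<lambda>a. a mod 16 = 0) (take 10 (bsubst [0, 1, 0, 0, 1] cand_T))"
    by code_simp
  then obtain T where T: "beval fps_X y cand_T = fps_X ^ 10 * T"
    unfolding y_def by (rule cand_no_pole) simp
  define A2 where "A2 = A1 + 1 + T"
  define A3 where "A3 = 11 * theta A1 + A2 + 2 * A1 + A1 * T"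
  define A4 where "A4 = 11 * theta A2 + A3 + 3 * A2 + A2 * T"
  define A5 where "A5 = 11 * theta A3 + A4 + 4 * A3 + A3 * T"
  define A where "A = (\<lambda>k :: nat. if k = 1 then A1 else if k = 2 then A2 else if k = 3 then A3
    else if k = 4 then A4 else if k = 5 then A5 else (0 :: 16 fps))"
  have "riccati_system A T"
  proof (rule candidate_algebra)
    show "beval fps_X y cand_m1 = fps_X ^ 5 * A 1" "beval fps_X y cand_T = fps_X ^ 10 * T"
      by (simp_all add: A1 T A_def)
    show "beval fps_X y cand_m2 = fps_X ^ 5 * beval fps_X y cand_m1 + (fps_X ^ 10 + beval fps_X y cand_T)"
      by (simp add: cand_m2_def)
    show "A 2 = A 1 + 1 + T" "A 3 = 11 * theta (A 1) + A 2 + 2 * A 1 + A 1 * T"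
      "A 4 = 11 * theta (A 2) + A 3 + 3 * A 2 + A 2 * T"
      "A 5 = 11 * theta (A 3) + A 4 + 4 * A 3 + A 3 * T"
      by (simp_all add: A_def A2_def A3_def A4_def A5_def)
  next
    show "11 * fps_X ^ 10 * theta (beval fps_X y cand_m1) - 52 * fps_X ^ 10 * beval fps_X y cand_m1
        + fps_X ^ 15 + fps_X ^ 5 * beval fps_X y cand_T + beval fps_X y cand_m1 * beval fps_X y cand_T
        = beval fps_X y cand_m3"
      by (rule right_minus_eq[THEN iffD1], rule HOL.trans[OF _ check[OF cand_check_1]])
        (simp add: theta algebra_simps)
    show "fps_X ^ 15 * beval fps_X y cand_m1 = fps_X ^ 20 + fps_X ^ 23 + fps_X ^ 15 *
      (11 * fps_X ^ 10 * theta (beval fps_X y cand_m2) - 107 * fps_X ^ 10 * beval fps_X y cand_m2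
        + fps_X ^ 5 * beval fps_X y cand_m3 + beval fps_X y cand_m2 * beval fps_X y cand_T)"
      by (rule HOL.sym, rule right_minus_eq[THEN iffD1], rule HOL.trans[OF _ check[OF cand_check_2]])
        (simp add: theta algebra_simps)
    show "fps_X ^ 15 * beval fps_X y cand_m2 = 2 * fps_X ^ 20 * beval fps_X y cand_m1 +
        fps_X ^ 23 * beval fps_X y cand_m1 - fps_X ^ 28 + fps_X ^ 15 *
      (11 * fps_X ^ 10 * theta (beval fps_X y cand_m3) - 161 * fps_X ^ 10 * beval fps_X y cand_m3
        + beval fps_X y cand_m3 * beval fps_X y cand_T)"
      by (rule HOL.sym, rule right_minus_eq[THEN iffD1], rule HOL.trans[OF _ check[OF cand_check_3]])
        (simp add: theta algebra_simps)
  qed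
  with T show thesis unfolding y_def by (rule that[rotated])
qed

section \<open>The substitution of w^3 for z\<close>

lemma fps_compose_X_power_theta:
  assumes "d > 0"
  shows "theta (fps_compose f (fps_X ^ d)) = of_nat d * fps_compose (theta f) (fps_X ^ d)"
proof (rule fps_ext)
  fix n
  show "fps_nth (theta (fps_compose f (fps_X ^ d))) n =
      fps_nth (of_nat d * fps_compose (theta f) (fps_X ^ d)) n"
    by (cases "d dvd n")
      (auto simp: theta_nth fps_nth_compose_X_power assms mult.assoc simp flip: fps_of_nat elim!: dvdE)
qed

text \<open>Substitution is a ring homomorphism; only the derivation changes, by the factor 3, which
  11 inverts modulo 16.\<close>

lemma riccati_system_of_int_system:
  fixes a :: "nat \<Rightarrow> int fps"
  assumes "a 2 = a 1 + 1 + T"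
    "a 3 = theta (a 1) + a 2 + 2 * a 1 + a 1 * T"
    "a 4 = theta (a 2) + a 3 + 3 * a 2 + a 2 * T"
    "a 5 = theta (a 3) + a 4 + 4 * a 3 + a 3 * T"
    "a 1 = 1 + fps_X + fps_X ^ 5 * a 4"
    "a 2 = 1 + (1 + fps_X) * a 1 + fps_X ^ 5 * a 5"
  defines "c \<equiv> \<lambda>f. fps_of_int_fps (fps_compose f (fps_X ^ 3)) :: 16 fps"
  shows "riccati_system (\<lambda>k. c (a k)) (c T)"
proof -
  have c_add: "c (f + g) = c f + c g" and c_mult: "c (f * g) = c f * c g" for f g
    by (simp_all add: c_def fps_compose_add_distrib fps_compose_mult_distrib)
  have c_1: "c 1 = 1" and c_X: "c fps_X = fps_X ^ 3"
    by (simp_all add: c_def)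
  have c_numeral: "c (numeral k) = numeral k" for k
    by (simp add: c_def fps_numeral_fps_const) (simp flip: fps_numeral_fps_const)
  have c_power: "c (f ^ n) = c f ^ n" for f n
    by (induction n) (simp_all add: c_1 c_mult)
  have c_X5: "c (fps_X ^ 5) = fps_X ^ 15"
    by (simp add: c_power c_X flip: power_mult)
  have c_theta: "c (theta f) = 11 * theta (c f)" for f
  proof -
    have "11 * theta (c f) = 33 * c (theta f)"
      by (simp add: c_def fps_compose_X_power_theta flip: fps_of_int_fps_theta)
    also have "(33 :: 16 fps) = 2 * 16 + 1" by simp
    finally show ?thesis by (simp only: fps_mod_16 mult_zero_right add_0_left mult_1_left)
  qed
  note c = c_add c_mult c_1 c_X c_numeral c_X5 c_theta
  have "c (a 2) = c (a 1) + 1 + c T"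
    "c (a 3) = 11 * theta (c (a 1)) + c (a 2) + 2 * c (a 1) + c (a 1) * c T"
    "c (a 4) = 11 * theta (c (a 2)) + c (a 3) + 3 * c (a 2) + c (a 2) * c T"
    "c (a 5) = 11 * theta (c (a 3)) + c (a 4) + 4 * c (a 3) + c (a 3) * c T"
    "c (a 1) = 1 + fps_X ^ 3 + fps_X ^ 15 * c (a 4)"
    "c (a 2) = 1 + (1 + fps_X ^ 3) * c (a 1) + fps_X ^ 15 * c (a 5)"
    by (subst assms(1), simp only: c) (subst assms(2), simp only: c, subst assms(3), simp only: c,
      subst assms(4), simp only: c, subst assms(5), simp only: c, subst assms(6), simp only: c)
  then show ?thesis
    unfolding riccati_system_def by blast
qed

text \<open>The given solution and the candidate solve the same system modulo 16, so uniqueness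
  identifies their \<open>T\<close>.\<close>

lemma riccati_system_cong_cand_T:
  assumes "riccati_system (\<lambda>k. fps_of_int_fps (a k)) (fps_of_int_fps T :: 16 fps)"
  shows "16 dvd fps_X ^ 10 * T - beval fps_X phi cand_T"
proof -
  obtain A and U :: "16 fps" where "riccati_system A U" and U: "beval fps_X (fps_of_int_fps phi) cand_T = fps_X ^ 10 * U"
    using cand_riccati by blast
  with assms have "fps_of_int_fps T = U"
    using riccati_system_unique by blast
  with U have "fps_of_int_fps (fps_X ^ 10 * T) = (fps_of_int_fps (beval fps_X phi cand_T) :: 16 fps)"
    by simp
  then show ?thesis
    by (simp only: fps_of_int_fps_mod_16_eq_iff)
qed

section \<open>Unfolding the tables into Laurent monomials\<close>

lemma fps_to_fls_peval: "fps_to_fls (peval w p) = peval (fps_to_fls w) p"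
  by (induction p) (simp_all add: fls_times_fps_to_fls)

lemma fps_to_fls_beval: "fps_to_fls (beval w y P) = beval (fps_to_fls w) (fps_to_fls y) P"
  by (induction P) (simp_all add: fps_to_fls_peval fls_times_fps_to_fls)

text \<open>The starting exponent is carried along, so that a row of a table unfolds directly into
  monomials, those with negative exponents included.\<close>

definition laurent_row :: "int \<Rightarrow> int list \<Rightarrow> int fls" where
  "laurent_row k p = fls_X_intpow k * peval fls_X p"

lemma laurent_row_Nil: "laurent_row k [] = 0"
  by (simp add: laurent_row_def)

lemma laurent_row_Cons: "laurent_row k (a # p) = of_int a * fls_X_intpow k + laurent_row (k + 1) p"
proof -
  have "fls_X_intpow (k + 1) = fls_X_intpow k * (fls_X :: int fls)"
    by (simp only: fls_X_intpow_times_fls_X_intpow[symmetric] fls_X_conv_shift_1)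
  then show ?thesis
    by (simp only: laurent_row_def peval.simps distrib_left mult_ac)
qed

lemma laurent_beval:
  "fls_X_intpow k * beval fls_X y [] = 0"
  "fls_X_intpow k * beval fls_X y (p # P) = laurent_row k p + y * (fls_X_intpow k * beval fls_X y P)"
  by (simp_all only: laurent_row_def beval.simps distrib_left mult_ac mult_zero_left mult_zero_right)

lemma laurent_row_0: "laurent_row k (0 # p) = laurent_row (k + 1) p"
  by (simp only: laurent_row_Cons of_int_0 mult_zero_left add_0_left)

section \<open>The subgroup numbers of the Hecke group\<close>

lemma action_number_C2: "action_number (integer_mod_group 2) (n + 2) =
    action_number (integer_mod_group 2) (n + 1) + (n + 1) * action_number (integer_mod_group 2) n"
  using action_number_cyclic_prime(2)[OF two_is_prime_nat, of "n + 1"] by simp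

text \<open>Turns the binomial coefficient of the recursion for \<open>p = 5\<close> into the
  polynomial factor of the recurrence.\<close>

lemma choose_4_fact: "((n + 4) choose 4) * fact 4 = (n + 4) * (n + 3) * (n + 2) * (n + 1)"
proof -
  have "fact 4 * fact n * ((n + 4) choose 4) = fact (n + 4)"
    using binomial_fact_lemma[of 4 "n + 4"] by simp
  also have "\<dots> = (n + 4) * (n + 3) * (n + 2) * (n + 1) * fact n"
    by (simp add: eval_nat_numeral algebra_simps)
  finally have "fact n * (((n + 4) choose 4) * fact 4) = fact n * ((n + 4) * (n + 3) * (n + 2) * (n + 1))"
    by (simp only: mult_ac)
  then show ?thesis by (simp only: mult_cancel1 fact_nonzero simp_thms)
qed

lemma action_number_C5: "action_number (integer_mod_group 5) (n + 5) =
    action_number (integer_mod_group 5) (n + 4) +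
    (n + 4) * (n + 3) * (n + 2) * (n + 1) * action_number (integer_mod_group 5) n"
proof -
  have n: "n + 5 = Suc (n + 4)" by simp
  show ?thesis
    unfolding n choose_4_fact[symmetric]
    using action_number_cyclic_prime(2)[of 5 "n + 4"] by (simp add: mult.assoc)
qed

lemma action_number_C5_small: "n < 5 \<Longrightarrow> action_number (integer_mod_group 5) n = 1"
  by (induction n) (simp_all add: action_number_cyclic_prime)

text \<open>Hall's recursion as a differential equation: division by \<open>fact m\<close> turns
  \<open>(m choose j) * fact j\<close> into \<open>1 / fact (m - j)\<close>, and the sum becomes a
  Cauchy product.\<close>

lemma theta_hecke_5:
  defines "W \<equiv> weighted_series (action_number (integer_mod_group 2)) (action_number (integer_mod_group 5)) 0"
  shows "theta W = fps_of_int_fps (fps_X * subgroup_series (hecke_group 5)) * W"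
proof (rule fps_ext)
  have grp: "group (hecke_group 5)" "group (integer_mod_group q)" for q
    by (simp_all add: hecke_group_def group_free_product group_integer_mod_group)
  have finZ: "finite (actions (integer_mod_group q) Y)" if "q > 0" "finite Y" for q and Y :: "nat set"
    using that by (intro finite_actions_finite_group) (auto simp: carrier_integer_mod_group)
  have fin: "finite (actions (hecke_group 5) Y)" if "finite Y" for Y :: "nat set"
    unfolding hecke_group_def using that by (intro finite_actions_free_product grp finZ) simp_all
  let ?h = "action_number (hecke_group 5)"
  \<comment> \<open>An action of the free product is a pair of actions of the factors, so
    \<open>W\<close> is the exponential generating function of the action numbers of the Hecke
    group.\<close>
  have W: "fps_nth W n = of_nat (?h n) / fact n" for n
    by (simp add: W_def weighted_series_def hecke_group_def action_number_free_product group_integer_mod_group)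
  fix n
  show "fps_nth (theta W) n = fps_nth (fps_of_int_fps (fps_X * subgroup_series (hecke_group 5)) * W) n"
  proof (cases n)
    case (Suc m)
    have "fps_nth (theta W) n = of_nat (?h (Suc m)) / fact m"
      by (simp add: theta_nth W Suc divide_simps)
    also have "?h (Suc m) = (\<Sum>j\<le>m. (m choose j) * (fact j * subgroup_number (Suc j) (hecke_group 5) * ?h (m - j)))"
      by (rule group.action_number_Suc[OF grp(1) fin])
    also have "of_nat \<dots> / fact m =
        (\<Sum>j\<le>m. of_nat (subgroup_number (Suc j) (hecke_group 5)) * (of_nat (?h (m - j)) / fact (m - j)) :: rat)"
      unfolding of_nat_sum sum_divide_distrib
      by (intro sum.cong) (simp_all add: binomial_fact divide_simps)
    also have "\<dots> = fps_nth (fps_of_int_fps (subgroup_series (hecke_group 5)) * W) m"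
      by (simp add: fps_mult_nth W subgroup_series_def atLeast0AtMost)
    also have "\<dots> = fps_nth (fps_X * (fps_of_int_fps (subgroup_series (hecke_group 5)) * W)) n"
      by (simp add: Suc)
    finally show ?thesis
      by (simp only: fps_of_int_fps_mult fps_of_int_fps_X mult.assoc)
  qed (simp add: theta_nth)
qed

text \<open>The exponent is \<open>13 = 10 + 3\<close>: ten from the scaling of
  \<open>cand_T\<close> and three from \<open>T = z S\<close> with \<open>z = w^3\<close>.\<close>

lemma hecke_5_cong:
  "16 dvd fps_X ^ 13 * fps_compose (subgroup_series (hecke_group 5)) (fps_X ^ 3) - beval fps_X phi cand_T"
proof -
  let ?T = "fps_X * subgroup_series (hecke_group 5)"
  have t01: "action_number (integer_mod_group 2) 0 = 1" "action_number (integer_mod_group 2) 1 = 1"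
    using action_number_cyclic_prime[of 2] by simp_all
  have "\<exists>a. riccati_system (\<lambda>k. fps_of_int_fps (fps_compose (a k) (fps_X ^ 3)))
      (fps_of_int_fps (fps_compose ?T (fps_X ^ 3)) :: 16 fps)"
  proof (rule riccati_system_int[OF action_number_C2 t01 action_number_C5 _ theta_hecke_5])
    show "action_number (integer_mod_group 5) n = 1" if "n < 5" for n
      using that by (rule action_number_C5_small)
  qed (intro exI, rule riccati_system_of_int_system)
  then obtain a where "riccati_system (\<lambda>k. fps_of_int_fps (fps_compose (a k) (fps_X ^ 3)))
      (fps_of_int_fps (fps_compose ?T (fps_X ^ 3)) :: 16 fps)" ..
  from riccati_system_cong_cand_T[OF this] have "16 dvd fps_X ^ 10 * fps_compose ?T (fps_X ^ 3) - beval fps_X phi cand_T" .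
  moreover have "fps_X ^ 10 * fps_compose ?T (fps_X ^ 3) =
      fps_X ^ 13 * fps_compose (subgroup_series (hecke_group 5)) (fps_X ^ 3)"
    by (simp add: fps_compose_mult_distrib flip: mult.assoc power_add)
  ultimately show ?thesis by simp
qed

text \<open>Among Laurent series \<open>w^13\<close> is invertible, and dividing by it leaves the
  constant factor 16 of the error intact.\<close>

lemma fls_cong_scaled:
  assumes "16 dvd fps_X ^ 13 * f - g"
  shows "fls_cong (fps_to_fls f) (zroot (- 13) * fps_to_fls g) 16"
proof -
  from assms obtain q where "fps_X ^ 13 * f - g = 16 * q" ..
  then have "fps_X ^ 13 * f = g + 16 * q" by (simp add: algebra_simps)
  then have "fps_to_fls (fps_X ^ 13 * f) = fps_to_fls (g + fps_const 16 * q)"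
    by (simp only: fps_numeral_fps_const)
  then have "zroot (- 13) * (zroot 13 * fps_to_fls f) =
      zroot (- 13) * (fps_to_fls g + fls_const 16 * fps_to_fls q)"
    by (simp add: fls_times_fps_to_fls fps_to_fls_power fls_X_power_conv_shift_1)
  then have "fps_to_fls f = zroot (- 13) * fps_to_fls g + fls_const 16 * (zroot (- 13) * fps_to_fls q)"
    by (simp only: mult.assoc[symmetric] fls_X_intpow_times_fls_X_intpow distrib_left)
       (simp add: mult_ac)
  then show ?thesis by (simp add: fls_cong_def cong_def)
qed

theorem theorem37:
  shows "fls_cong (in_z (subgroup_series (hecke_group 5)))
    (8 * zpow 12 + 4 * zpow 9 + 8 * zpow 7 + 8 * zpow 5 + 2 * zpow 4 + 8 * zpow 2
         + 4 * zpow 1 + 14 + 7 * zpow (-3)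
      + (8 * zroot 20 + 8 * zroot 5 + 8 * zroot (-1) + 8 * zroot (-4) + 12 * zroot (-10)) * Phi2
      + (8 * zroot 19 + 8 * zroot 4 + 12 * zroot (-2) + 8 * zroot (-5) + 10 * zroot (-11)) * Phi2 ^ 2
      + (8 * zpow 6 + 8 * zpow 1 + 8 * zpow (-1) + 12 * zpow (-4)) * Phi2 ^ 3
      + (8 * zroot 32 + 8 * zroot 20 + 8 * zroot 11 + 8 * zroot 8 + 8 * zroot 5
         + 6 * zroot (-4) + 8 * zroot (-7) + 12 * zroot (-10) + 7 * zroot (-13)) * Phi2 ^ 4
      + (8 * zroot (-2) + 8 * zroot (-5) + 8 * zroot (-8) + 4 * zroot (-11)) * Phi2 ^ 5
      + (8 * zpow 6 + 8 * zpow 1 + 8 * zpow (-1) + 12 * zpow (-2) + 4 * zpow (-4)) * Phi2 ^ 6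
      + (8 * zroot (-4) + 8 * zroot (-7) + 12 * zroot (-13)) * Phi2 ^ 7
      + (8 * zroot 22 + 8 * zroot 19 + 8 * zroot 16 + 8 * zroot 10 + 12 * zroot 7
         + 8 * zroot 4 + 4 * zroot (-2) + 8 * zroot (-5) + 5 * zroot (-8)
         + 2 * zroot (-11)) * Phi2 ^ 8
      + (8 * zpow 6 + 8 * zpow 1 + 8 * zpow (-1) + 4 * zpow (-4) + 8 * zpow (-2)) * Phi2 ^ 9
      + (12 * zroot (-4) + 2 * zroot (-13)) * Phi2 ^ 10
      + (8 * zroot (-8)) * Phi2 ^ 11
      + (8 * zpow 6 + 8 * zpow 4 + 8 * zpow 1 + 8 + 8 * zpow (-1) + 12 * zpow (-2)
         + 12 * zpow (-3) + 12 * zpow (-4)) * Phi2 ^ 12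
      + (8 * zroot (-4) + 8 * zroot (-7) + 12 * zroot (-13)) * Phi2 ^ 13
      + (4 * zroot (-8) + 8 * zroot (-11)) * Phi2 ^ 14)
    16"
  (is "fls_cong _ ?R 16")
proof -
  \<comment> \<open>Expands the nested form in which \<open>beval\<close> evaluates a table with 15
    rows.\<close>
  have horner: "r0 + Phi2 * (r1 + Phi2 * (r2 + Phi2 * (r3 + Phi2 * (r4 + Phi2 * (r5 + Phi2 * (r6 +
      Phi2 * (r7 + Phi2 * (r8 + Phi2 * (r9 + Phi2 * (r10 + Phi2 * (r11 + Phi2 * (r12 + Phi2 * (r13 +
      Phi2 * (r14 + Phi2 * 0)))))))))))))) =
      r0 + r1 * Phi2 + r2 * Phi2 ^ 2 + r3 * Phi2 ^ 3 + r4 * Phi2 ^ 4 + r5 * Phi2 ^ 5 + r6 * Phi2 ^ 6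
      + r7 * Phi2 ^ 7 + r8 * Phi2 ^ 8 + r9 * Phi2 ^ 9 + r10 * Phi2 ^ 10 + r11 * Phi2 ^ 11
      + r12 * Phi2 ^ 12 + r13 * Phi2 ^ 13 + r14 * Phi2 ^ 14"
    for r0 r1 r2 r3 r4 r5 r6 r7 r8 r9 r10 r11 r12 r13 r14
    by (simp add: algebra_simps eval_nat_numeral)
  \<comment> \<open>Row \<open>i\<close> of \<open>cand_T\<close>, multiplied by
    \<open>w^(-13)\<close>, is the coefficient of \<open>Phi2 ^ i\<close> in the claim.\<close>
  have R: "zroot (- 13) * beval fls_X Phi2 cand_T = ?R"
    unfolding cand_T_def laurent_beval horner
    by (simp add: laurent_row_0 laurent_row_Cons laurent_row_Nil add.commute add.left_commute del: fls_of_int)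
  have "Phi2 = fps_to_fls phi" by (simp add: Phi2_def phi_def)
  then have "zroot (- 13) * fps_to_fls (beval fps_X phi cand_T) = zroot (- 13) * beval fls_X Phi2 cand_T"
    by (simp add: fps_to_fls_beval)
  moreover have "in_z (subgroup_series (hecke_group 5)) =
      fps_to_fls (fps_compose (subgroup_series (hecke_group 5)) (fps_X ^ 3))"
    by (rule fls_compose_power_fps_to_fls) simp
  ultimately show ?thesis
    using fls_cong_scaled[OF hecke_5_cong] by (simp only: R)
qed

end
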